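(* For every finite simple graph $G=(V,E)$ with maximum degree $\Delta$ there is a cograph $k$-decomposition with $1\le k\le\Delta+1$, and such a decomposition (together with cotrees for its parts) can be computed in $O(|V||E|+\Delta(|V|+|E|))$ time. Hence every graph can be represented by at most $\Delta+1$ cotrees.
   Context: A cograph is a finite simple graph with no induced path on four vertices. A cograph $k$-decomposition of $G=(V,E)$ is a family $\{E_1,\dots,E_k\}$ of subsets of $E$ with $\bigcup_i E_i=E$ (not necessarily disjoint) such that each $(V,E_i)$ is a cograph. A cotree on leaf set $V$ is a rooted tree $T$ with leaf set $V$ and labels $t\colon\text{inner vertices}\to\{0,1\}$ (the cotree of a cograph $H$ on $V$ satisfies $[x,y]\in E(H)$ iff $t(\mathrm{lca}_T(x,y))=1$). $G$ is represented by a set of cotrees $\{T_1,\dots,T_k\}$, each with leaf set $V$, if for each edge $[x,y]\in E$ there is some $T_i$ with $t(\mathrm{lca}_{T_i}(x,y))=1$ (and each $T_i$ is the cotree of a subgraph $(V,E_i)$ of $G$).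
   Formalization: For edgeless graphs the stated time bound is 0, which no algorithm can meet; there the bound is taken as |V|+1. For the graph without vertices, where no cotree exists, the algorithm outputs a decomposition and no cotrees, and the representing set of cotrees is empty. *)

theory Defs
  imports Main
begin

definition simple_graph :: "'a set \<Rightarrow> 'a set set \<Rightarrow> bool" where
  "simple_graph V E \<longleftrightarrow> finite V \<and> (\<forall>e\<in>E. e \<subseteq> V \<and> card e = 2)"

definition degree :: "'a set set \<Rightarrow> 'a \<Rightarrow> nat" where
  "degree E v = card {e \<in> E. v \<in> e}"

text \<open>The inserted 0 only matters for the graph without vertices.\<close>

definition max_degree :: "'a set \<Rightarrow> 'a set set \<Rightarrow> nat" where
  "max_degree V E = Max (insert 0 (degree E ` V))"

definition induces_P4 :: "'a set set \<Rightarrow> 'a \<Rightarrow> 'a \<Rightarrow> 'a \<Rightarrow> 'a \<Rightarrow> bool" where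
  "induces_P4 E a b c d \<longleftrightarrow> distinct [a, b, c, d] \<and>
     {a, b} \<in> E \<and> {b, c} \<in> E \<and> {c, d} \<in> E \<and>
     {a, c} \<notin> E \<and> {b, d} \<notin> E \<and> {a, d} \<notin> E"

definition cograph :: "'a set \<Rightarrow> 'a set set \<Rightarrow> bool" where
  "cograph V E \<longleftrightarrow> simple_graph V E \<and>
     \<not> (\<exists>a\<in>V. \<exists>b\<in>V. \<exists>c\<in>V. \<exists>d\<in>V. induces_P4 E a b c d)"

definition cograph_decomposition :: "'a set \<Rightarrow> 'a set set \<Rightarrow> nat \<Rightarrow> 'a set set list \<Rightarrow> bool" where
  "cograph_decomposition V E k Es \<longleftrightarrow> length Es = k \<and>
     (\<Union>F\<in>set Es. F) = E \<and> (\<forall>F\<in>set Es. F \<subseteq> E \<and> cograph V F)"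


text \<open>The label \<open>True\<close> stands for 1 and \<open>False\<close> for 0.\<close>

datatype (leaves: 'a) cotree = Leaf 'a | Node (label: bool) (children: "'a cotree list")

fun leaf_list :: "'a cotree \<Rightarrow> 'a list" where
  "leaf_list (Leaf x) = [x]"
| "leaf_list (Node b ts) = concat (map leaf_list ts)"

fun subtrees :: "'a cotree \<Rightarrow> 'a cotree set" where
  "subtrees (Leaf x) = {Leaf x}"
| "subtrees (Node b ts) = insert (Node b ts) (\<Union>t\<in>set ts. subtrees t)"

text \<open>An inner vertex has at least one child (otherwise it would be a leaf), and every
  element of \<open>V\<close> labels exactly one leaf. Under these conditions the vertices of the tree
  correspond bijectively to its subtrees, with \<open>s \<in> subtrees s'\<close> meaning that the
  vertex \<open>s\<close> is a descendant of \<open>s'\<close>.\<close>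

definition cotree_on :: "'a set \<Rightarrow> 'a cotree \<Rightarrow> bool" where
  "cotree_on V T \<longleftrightarrow> leaves T = V \<and> distinct (leaf_list T) \<and>
     (\<forall>b. Node b [] \<notin> subtrees T)"

definition lca :: "'a cotree \<Rightarrow> 'a \<Rightarrow> 'a \<Rightarrow> 'a cotree" where
  "lca T x y = (THE s. s \<in> subtrees T \<and> x \<in> leaves s \<and> y \<in> leaves s \<and>
     (\<forall>s'\<in>subtrees T. x \<in> leaves s' \<and> y \<in> leaves s' \<longrightarrow> s \<in> subtrees s'))"

definition cotree_of :: "'a set \<Rightarrow> 'a set set \<Rightarrow> 'a cotree \<Rightarrow> bool" where
  "cotree_of V F T \<longleftrightarrow> cotree_on V T \<and>
     (\<forall>x\<in>V. \<forall>y\<in>V. x \<noteq> y \<longrightarrow> ({x, y} \<in> F \<longleftrightarrow> label (lca T x y)))"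

definition represented_by :: "'a set \<Rightarrow> 'a set set \<Rightarrow> 'a cotree set \<Rightarrow> bool" where
  "represented_by V E TT \<longleftrightarrow>
     (\<forall>T\<in>TT. \<exists>F\<subseteq>E. cotree_of V F T) \<and>
     (\<forall>x y. {x, y} \<in> E \<longrightarrow> (\<exists>T\<in>TT. label (lca T x y)))"


text \<open>Running times refer to while-programs over a random access memory. The memory is
  organised in arrays of natural numbers; array names are fixed in the program text, so a
  program uses a constant number of arrays, and indices are computed at run time. The only
  arithmetic is addition and truncated subtraction. Every assignment and every test
  takes one time unit; as the expressions of a program have constant size, this agrees up to
  a constant factor with charging one unit per elementary operation.\<close>

type_synonym vname = string
type_synonym state = "vname \<Rightarrow> nat \<Rightarrow> nat"

datatype aexp = N nat | Read vname aexp | Plus aexp aexp | Minus aexp aexp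

datatype bexp = Less aexp aexp | Not bexp | And bexp bexp

datatype com =
    Skip
  | Write vname aexp aexp
  | Seq com com
  | If bexp com com
  | While bexp com

fun aval :: "aexp \<Rightarrow> state \<Rightarrow> nat" where
  "aval (N n) s = n"
| "aval (Read x a) s = s x (aval a s)"
| "aval (Plus a b) s = aval a s + aval b s"
| "aval (Minus a b) s = aval a s - aval b s"

fun bval :: "bexp \<Rightarrow> state \<Rightarrow> bool" where
  "bval (Less a b) s \<longleftrightarrow> aval a s < aval b s"
| "bval (Not b) s \<longleftrightarrow> \<not> bval b s"
| "bval (And b c) s \<longleftrightarrow> bval b s \<and> bval c s"

text \<open>\<open>exec P s t s'\<close>: started in \<open>s\<close>, the program \<open>P\<close> halts after exactly \<open>t\<close>
  time units in \<open>s'\<close>.\<close>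

inductive exec :: "com \<Rightarrow> state \<Rightarrow> nat \<Rightarrow> state \<Rightarrow> bool" where
  Skip: "exec Skip s 1 s"
| Write: "exec (Write x a b) s 1 (s(x := (s x)(aval a s := aval b s)))"
| Seq: "exec P s t1 s' \<Longrightarrow> exec Q s' t2 s'' \<Longrightarrow> exec (Seq P Q) s (t1 + t2) s''"
| IfTrue: "bval b s \<Longrightarrow> exec P s t s' \<Longrightarrow> exec (If b P Q) s (1 + t) s'"
| IfFalse: "\<not> bval b s \<Longrightarrow> exec Q s t s' \<Longrightarrow> exec (If b P Q) s (1 + t) s'"
| WhileFalse: "\<not> bval b s \<Longrightarrow> exec (While b P) s 1 s"
| WhileTrue: "bval b s \<Longrightarrow> exec P s t1 s' \<Longrightarrow> exec (While b P) s' t2 s'' \<Longrightarrow>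
    exec (While b P) s (1 + t1 + t2) s''"

definition load :: "nat list \<Rightarrow> state" where
  "load xs = (\<lambda>x i. if x = ''in'' \<and> i < length xs then xs ! i else 0)"

definition outputs :: "state \<Rightarrow> nat list \<Rightarrow> bool" where
  "outputs s ys \<longleftrightarrow> (\<forall>i < length ys. s ''out'' i = ys ! i)"


definition edges_of :: "(nat \<times> nat) list \<Rightarrow> nat set set" where
  "edges_of es = (\<lambda>(u, v). {u, v}) ` set es"

text \<open>A graph with vertices \<open>0, \<dots>, n - 1\<close> is given by a list that contains each
  of its edges exactly once, in any order and with the end points in any order.\<close>

definition graph_input :: "nat \<Rightarrow> (nat \<times> nat) list \<Rightarrow> bool" where
  "graph_input n es \<longleftrightarrow> (\<forall>(u, v)\<in>set es. u < n \<and> v < n \<and> u \<noteq> v) \<and>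
     distinct (map (\<lambda>(u, v). {u, v}) es)"

definition enc_edges :: "(nat \<times> nat) list \<Rightarrow> nat list" where
  "enc_edges es = length es # concat (map (\<lambda>(u, v). [u, v]) es)"

definition enc_graph :: "nat \<Rightarrow> (nat \<times> nat) list \<Rightarrow> nat list" where
  "enc_graph n es = n # enc_edges es"

text \<open>Preorder traversal with the number of children at each inner vertex; all encodings
  are prefix-free.\<close>

fun enc_cotree :: "nat cotree \<Rightarrow> nat list" where
  "enc_cotree (Leaf v) = [0, v]"
| "enc_cotree (Node b ts) = [if b then 2 else 1, length ts] @ concat (map enc_cotree ts)"

definition enc_result :: "(nat \<times> nat) list list \<Rightarrow> nat cotree list \<Rightarrow> nat list" where
  "enc_result Fs Ts = length Fs # concat (map enc_edges Fs) @ length Ts # concat (map enc_cotree Ts)"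

text \<open>A rooted tree has at least one leaf, so for \<open>n = 0\<close> there is no cotree to output.\<close>

definition correct_result ::
    "nat \<Rightarrow> (nat \<times> nat) list \<Rightarrow> (nat \<times> nat) list list \<Rightarrow> nat cotree list \<Rightarrow> bool" where
  "correct_result n es Fs Ts \<longleftrightarrow>
     (\<exists>k. 1 \<le> k \<and> k \<le> max_degree {..<n} (edges_of es) + 1 \<and>
       cograph_decomposition {..<n} (edges_of es) k (map edges_of Fs)) \<and>
     (if n = 0 then Ts = [] else list_all2 (cotree_of {..<n}) (map edges_of Fs) Ts)"

text \<open>The expression \<open>n * m + \<Delta> * (n + m)\<close> vanishes for edgeless graphs, where even
  writing down a cotree takes time linear in \<open>n\<close>; for \<open>m > 0\<close> it dominates \<open>n\<close>.\<close>

definition time_bound :: "nat \<Rightarrow> nat \<Rightarrow> nat \<Rightarrow> nat" where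
  "time_bound n m \<Delta> = (if m = 0 then n + 1 else n * m + \<Delta> * (n + m))"

end

theory Submission
  imports Defs
begin

text \<open>
  Star forests are cographs, so it suffices to find at most \<open>\<Delta> + 1\<close> star forests that cover all
  edges. Scan the edges once and drop an edge whenever both of its end points still have degree at
  least 2: what is left is a minimal edge cover, in which every edge has an end point of degree 1,
  i.e. a star forest. As it meets every non-isolated vertex, removing it from the graph lowers the
  maximum degree, and after \<open>\<Delta>\<close> rounds no edge remains. A round takes linear time; in
  writing down its cotree one may spend \<open>O(n)\<close> on each star, since the stars of all rounds
  together number at most \<open>m\<close>.
\<close>

definition edge_set :: "('a \<times> 'a) list \<Rightarrow> 'a set set" where
  "edge_set es = (\<lambda>(u, v). {u, v}) ` set es"

definition list_degree :: "('a \<times> 'a) list \<Rightarrow> 'a \<Rightarrow> nat" where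
  "list_degree es x = length (filter (\<lambda>e. x = fst e \<or> x = snd e) es)"

lemma list_degree_Nil [simp]: "list_degree [] x = 0"
  by (simp add: list_degree_def)

lemma list_degree_Cons [simp]:
  "list_degree (e # es) x = (if x = fst e \<or> x = snd e then 1 else 0) + list_degree es x"
  by (simp add: list_degree_def)

lemma list_degree_append [simp]: "list_degree (es @ es') x = list_degree es x + list_degree es' x"
  by (simp add: list_degree_def)

lemma list_degree_pos: "(u, v) \<in> set es \<Longrightarrow> 0 < list_degree es u \<and> 0 < list_degree es v"
  by (induction es) auto

definition edges_within :: "'a set \<Rightarrow> ('a \<times> 'a) list \<Rightarrow> bool" where
  "edges_within V es \<longleftrightarrow> (\<forall>(u, v)\<in>set es. u \<in> V \<and> v \<in> V \<and> u \<noteq> v)"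

section \<open>Covering a graph by a star forest\<close>

text \<open>In a state \<open>(d, f, F, S)\<close>, the graph formed by the kept edges \<open>F\<close> and the edges not yet
  scanned has degrees \<open>d\<close>, \<open>S\<close> lists the edges put off, and \<open>f\<close> maps the leaves of the star
  forest \<open>F\<close> to their centres and fixes all other vertices.\<close>

fun cover_step :: "'a \<times> 'a \<Rightarrow> ('a \<Rightarrow> nat) \<times> ('a \<Rightarrow> 'a) \<times> ('a \<times> 'a) list \<times> ('a \<times> 'a) list \<Rightarrow>
    ('a \<Rightarrow> nat) \<times> ('a \<Rightarrow> 'a) \<times> ('a \<times> 'a) list \<times> ('a \<times> 'a) list" where
  "cover_step (u, v) (d, f, F, S) =
    (if d u < 2 then (d, f(u := v), F @ [(u, v)], S)
     else if d v < 2 then (d, f(v := u), F @ [(u, v)], S)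
     else (d(u := d u - 1, v := d v - 1), f, F, S @ [(u, v)]))"

definition cover :: "('a \<times> 'a) list \<Rightarrow> ('a \<times> 'a) list \<Rightarrow>
    ('a \<Rightarrow> nat) \<times> ('a \<Rightarrow> 'a) \<times> ('a \<times> 'a) list \<times> ('a \<times> 'a) list" where
  "cover R xs = fold cover_step xs (list_degree R, id, [], [])"

lemma cover_Nil [simp]: "cover R [] = (list_degree R, id, [], [])"
  by (simp add: cover_def)

lemma cover_snoc [simp]: "cover R (xs @ [e]) = cover_step e (cover R xs)"
  by (simp add: cover_def)

locale cover_inv =
  fixes V :: "'a set" and xs ys :: "('a \<times> 'a) list" and d :: "'a \<Rightarrow> nat" and f :: "'a \<Rightarrow> 'a"
    and F S :: "('a \<times> 'a) list"
  assumes finV: "finite V"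
    and d: "d x = list_degree F x + list_degree ys x"
    and FS: "list_degree F x + list_degree S x = list_degree xs x"
    and pos: "0 < list_degree xs x + list_degree ys x \<Longrightarrow> 0 < d x"
    and set_FS: "set F \<union> set S = set xs"
    and length_FS: "length F + length S = length xs"
    and nonroot: "f x \<noteq> x \<Longrightarrow> x \<in> V \<and> f x \<in> V \<and> d x = 1 \<and> f (f x) = f x \<and>
       ((x, f x) \<in> set F \<or> (f x, x) \<in> set F)"
    and edge: "(u, v) \<in> set F \<Longrightarrow> f u = v \<or> f v = u"
    and degree_F: "list_degree F x = card {y \<in> V. y \<noteq> x \<and> f y = x} + (if f x \<noteq> x then 1 else 0)"
    and card_nonroots: "card {x \<in> V. f x \<noteq> x} = length F"

lemma cover_inv_attach:
  assumes inv: "cover_inv V xs (e # ys) d f F S" and e: "e = (a, b) \<or> e = (b, a)"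
    and ab: "a \<noteq> b" "a \<in> V" "b \<in> V" and da: "d a < 2"
  shows "cover_inv V (xs @ [e]) ys d (f(a := b)) (F @ [e]) S"
proof -
  interpret cover_inv V xs "e # ys" d f F S by fact
  have Fa: "list_degree F a = 0" and ya: "list_degree ys a = 0"
    using d[of a] da e by auto
  have root: "f x = x" if "x = a \<or> x = b" for x
  proof (rule ccontr)
    assume "f x \<noteq> x"
    then have "d x = 1" "list_degree F x > 0"
      using nonroot[of x] list_degree_pos[of _ _ F] by blast+
    then show False using d[of x] e that by auto
  qed
  have F_a: "u \<noteq> a \<and> v \<noteq> a" if "(u, v) \<in> set F" for u v
    using list_degree_pos[OF that] Fa by auto
  have noa: "f y \<noteq> a" if "y \<noteq> a" for y
    using nonroot[of y] F_a[of y a] F_a[of a y] that by auto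
  have da1: "d a = 1" using d[of a] e Fa ya by auto
  have children: "{y \<in> V. y \<noteq> x \<and> (f(a := b)) y = x} =
      (if x = b then insert a {y \<in> V. y \<noteq> x \<and> f y = x} else {y \<in> V. y \<noteq> x \<and> f y = x})" for x
    using ab root[of a] by auto
  have nonroots: "{x \<in> V. (f(a := b)) x \<noteq> x} = insert a {x \<in> V. f x \<noteq> x}"
    using ab by auto
  show ?thesis
  proof
    show "finite V" by (rule finV)
    fix x
    show "d x = list_degree (F @ [e]) x + list_degree ys x"
      using d[of x] by simp
    show "list_degree (F @ [e]) x + list_degree S x = list_degree (xs @ [e]) x"
      using FS[of x] by simp
    show "0 < d x" if "0 < list_degree (xs @ [e]) x + list_degree ys x"
      by (rule pos) (use that in auto)
    show "set (F @ [e]) \<union> set S = set (xs @ [e])" using set_FS by auto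
    show "length (F @ [e]) + length S = length (xs @ [e])" using length_FS by simp
    show "card {x \<in> V. (f(a := b)) x \<noteq> x} = length (F @ [e])"
      unfolding nonroots using finV root[of a] card_nonroots by simp
    show "list_degree (F @ [e]) x =
        card {y \<in> V. y \<noteq> x \<and> (f(a := b)) y = x} + (if (f(a := b)) x \<noteq> x then 1 else 0)"
      unfolding children using degree_F[of x] e ab finV root[of a] root[of b] by auto
    show "x \<in> V \<and> (f(a := b)) x \<in> V \<and> d x = 1 \<and> (f(a := b)) ((f(a := b)) x) = (f(a := b)) x \<and>
       ((x, (f(a := b)) x) \<in> set (F @ [e]) \<or> ((f(a := b)) x, x) \<in> set (F @ [e]))"
      if "(f(a := b)) x \<noteq> x"
    proof (cases "x = a")
      case False
      then show ?thesis using that nonroot[of x] noa[of x] by auto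
    qed (use ab da1 e root[of b] in auto)
    show "(f(a := b)) u = v \<or> (f(a := b)) v = u" if "(u, v) \<in> set (F @ [e])" for u v
    proof (cases "(u, v) \<in> set F")
      case True
      then show ?thesis using F_a[of u v] edge[of u v] by auto
    qed (use that e in auto)
  qed
qed

lemma cover_inv_skip:
  assumes inv: "cover_inv V xs ((u, v) # ys) d f F S"
    and uv: "u \<noteq> v" and du: "2 \<le> d u" "2 \<le> d v"
  shows "cover_inv V (xs @ [(u, v)]) ys (d(u := d u - 1, v := d v - 1)) f F (S @ [(u, v)])"
proof -
  interpret cover_inv V xs "(u, v) # ys" d f F S by fact
  let ?d = "d(u := d u - 1, v := d v - 1)"
  show ?thesis
  proof
    fix x
    show "?d x = list_degree F x + list_degree ys x"
      using d[of x] uv by auto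
    show "list_degree F x + list_degree (S @ [(u, v)]) x = list_degree (xs @ [(u, v)]) x"
      using FS[of x] by simp
    show "0 < ?d x" if "0 < list_degree (xs @ [(u, v)]) x + list_degree ys x"
      using pos[of x] that du by auto
    show "set F \<union> set (S @ [(u, v)]) = set (xs @ [(u, v)])" using set_FS by auto
    show "length F + length (S @ [(u, v)]) = length (xs @ [(u, v)])" using length_FS by simp
    show "x \<in> V \<and> f x \<in> V \<and> ?d x = 1 \<and> f (f x) = f x \<and>
       ((x, f x) \<in> set F \<or> (f x, x) \<in> set F)" if "f x \<noteq> x"
      using nonroot[OF that] du by auto
  qed (rule finV degree_F card_nonroots edge; assumption?)+
qed

lemma cover_inv_cover:
  assumes "edges_within V (xs @ ys)" "finite V" "cover (xs @ ys) xs = (d, f, F, S)"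
  shows "cover_inv V xs ys d f F S"
  using assms(1,3)
proof (induction xs arbitrary: ys d f F S rule: rev_induct)
  case Nil
  then have "d = list_degree ys" "f = id" "F = []" "S = []" by simp_all
  then show ?case using assms(2) by unfold_locales auto
next
  case (snoc e xs)
  obtain u v where e: "e = (u, v)" by force
  have uv: "u \<in> V" "v \<in> V" "u \<noteq> v" using snoc.prems e by (auto simp: edges_within_def)
  obtain d' f' F' S' where c: "cover (xs @ e # ys) xs = (d', f', F', S')"
    by (rule prod_cases4)
  have inv: "cover_inv V xs (e # ys) d' f' F' S'" using snoc c by simp
  have step: "cover_step e (d', f', F', S') = (d, f, F, S)" using snoc.prems(2) c by simp
  show ?case
  proof (cases "d' u < 2 \<or> d' v < 2")
    case True
    then show ?thesis
      using cover_inv_attach[OF inv, of u v] cover_inv_attach[OF inv, of v u] step uv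
      by (auto simp: e split: if_splits)
  next
    case False
    then show ?thesis
      using cover_inv_skip[OF inv[unfolded e]] step uv by (auto simp: e)
  qed
qed

definition star_map :: "'a set \<Rightarrow> ('a \<Rightarrow> 'a) \<Rightarrow> bool" where
  "star_map V f \<longleftrightarrow> (\<forall>x\<in>V. f x \<in> V \<and> f (f x) = f x)"

definition star_edges :: "'a set \<Rightarrow> ('a \<Rightarrow> 'a) \<Rightarrow> 'a set set" where
  "star_edges V f = {{x, f x} | x. x \<in> V \<and> f x \<noteq> x}"

lemma cover_star_forest:
  assumes R: "edges_within V R" and V: "finite V" and c: "cover R R = (d, f, F, S)"
  shows "star_map V f" "edge_set F = star_edges V f"
    "set F \<union> set S = set R" "length F + length S = length R"
    "list_degree S x \<le> list_degree R x - 1"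
    "f x = x \<Longrightarrow> d x = card {y \<in> V. y \<noteq> x \<and> f y = x}"
    "card {x \<in> V. f x \<noteq> x} = length F"
proof -
  interpret cover_inv V R "[]" d f F S
    using cover_inv_cover[of V R "[]"] R V c by simp
  show "star_map V f" unfolding star_map_def
  proof
    fix x assume "x \<in> V"
    then show "f x \<in> V \<and> f (f x) = f x" using nonroot[of x] by (cases "f x = x") auto
  qed
  show "edge_set F = star_edges V f"
  proof
    show "edge_set F \<subseteq> star_edges V f"
    proof
      fix e assume "e \<in> edge_set F"
      then obtain u v where uv: "(u, v) \<in> set F" "e = {u, v}" by (auto simp: edge_set_def)
      then have "(u, v) \<in> set R" using set_FS by auto
      then have "u \<in> V" "v \<in> V" "u \<noteq> v" using R by (auto simp: edges_within_def)
      then show "e \<in> star_edges V f"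
        using edge[OF uv(1)] unfolding star_edges_def uv(2) by (auto simp: insert_commute)
    qed
    show "star_edges V f \<subseteq> edge_set F"
    proof
      fix e assume "e \<in> star_edges V f"
      then obtain x where "f x \<noteq> x" "e = {x, f x}" by (auto simp: star_edges_def)
      then show "e \<in> edge_set F"
        using nonroot[of x] by (force simp: edge_set_def image_iff)
    qed
  qed
  show "set F \<union> set S = set R" by (rule set_FS)
  show "length F + length S = length R" by (rule length_FS)
  show "card {x \<in> V. f x \<noteq> x} = length F" by (rule card_nonroots)
  show "list_degree S x \<le> list_degree R x - 1"
    using d[of x] FS[of x] pos[of x] by (cases "list_degree R x = 0") auto
  show "f x = x \<Longrightarrow> d x = card {y \<in> V. y \<noteq> x \<and> f y = x}"
    using d[of x] degree_F[of x] by simp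
qed

lemma cograph_star_edges:
  assumes "finite V" "star_map V f"
  shows "cograph V (star_edges V f)"
proof -
  have leaf: "(f x = y \<and> f y = y \<or> f y = x \<and> f x = x) \<and> x \<noteq> y" if "{x, y} \<in> star_edges V f" for x y
    using that assms(2) unfolding star_edges_def star_map_def by (auto simp: doubleton_eq_iff)
  have "\<not> induces_P4 (star_edges V f) a b c d" for a b c d
    unfolding induces_P4_def using leaf[of a b] leaf[of b c] leaf[of c d] by auto
  moreover have "simple_graph V (star_edges V f)"
    using assms unfolding simple_graph_def star_edges_def star_map_def by auto
  ultimately show ?thesis unfolding cograph_def by blast
qed

section \<open>Cotrees of star forests\<close>

lemma leaves_eq_leaf_list: "leaves T = set (leaf_list T)"
  by (induction T) auto

lemma subtrees_leaves: "s \<in> subtrees T \<Longrightarrow> leaves s \<subseteq> leaves T"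
  by (induction T) auto

lemma subtrees_size: "s \<in> subtrees T \<Longrightarrow> s = T \<or> size s < size T"
proof (induction T)
  case (Node b ts)
  then show ?case
    using size_list_estimation'[of _ ts _ size]
    by auto (metis less_Suc_eq_le order.refl size_list_estimation' trans_less_add1 le_SucI less_SucI less_imp_le)+
qed simp

definition is_lca :: "'a cotree \<Rightarrow> 'a \<Rightarrow> 'a \<Rightarrow> 'a cotree \<Rightarrow> bool" where
  "is_lca T x y s \<longleftrightarrow> s \<in> subtrees T \<and> x \<in> leaves s \<and> y \<in> leaves s \<and>
     (\<forall>s'\<in>subtrees T. x \<in> leaves s' \<and> y \<in> leaves s' \<longrightarrow> s \<in> subtrees s')"

lemma lca_eqI:
  assumes "is_lca T x y s"
  shows "lca T x y = s"
proof -
  have "s' = s" if "is_lca T x y s'" for s'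
    using that assms subtrees_size[of s s'] subtrees_size[of s' s]
    unfolding is_lca_def by fastforce
  then show ?thesis
    using assms unfolding lca_def is_lca_def by (intro the_equality) blast+
qed

lemma is_lca_child:
  assumes "is_lca t x y s" "t \<in> set ts" "\<And>t'. t' \<in> set ts \<Longrightarrow> x \<in> leaves t' \<Longrightarrow> t' = t"
  shows "is_lca (Node b ts) x y s"
  unfolding is_lca_def
proof (intro conjI ballI impI)
  show s: "s \<in> subtrees (Node b ts)" "x \<in> leaves s" "y \<in> leaves s"
    using assms by (auto simp: is_lca_def)
  fix s' assume s': "s' \<in> subtrees (Node b ts)" "x \<in> leaves s' \<and> y \<in> leaves s'"
  show "s \<in> subtrees s'"
  proof (cases "s' = Node b ts")
    case False
    then obtain t' where "t' \<in> set ts" "s' \<in> subtrees t'" using s' by auto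
    moreover from this have "t' = t" using assms(3) s' subtrees_leaves by blast
    ultimately show ?thesis using assms(1) s' by (auto simp: is_lca_def)
  qed (use s in simp)
qed

lemma is_lca_root:
  assumes "x \<in> leaves (Node b ts)" "y \<in> leaves (Node b ts)"
    "\<And>t. t \<in> set ts \<Longrightarrow> x \<in> leaves t \<Longrightarrow> y \<in> leaves t \<Longrightarrow> False"
  shows "is_lca (Node b ts) x y (Node b ts)"
  unfolding is_lca_def
proof (intro conjI ballI impI)
  fix s' assume s': "s' \<in> subtrees (Node b ts)" "x \<in> leaves s' \<and> y \<in> leaves s'"
  have "s' \<notin> subtrees t" if "t \<in> set ts" for t
    using assms(3)[OF that] s' subtrees_leaves by blast
  then have "s' = Node b ts" using s' by auto
  then show "Node b ts \<in> subtrees s'" by simp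
qed (use assms(1,2) in simp_all)

definition star_comp :: "'a list \<Rightarrow> ('a \<Rightarrow> 'a) \<Rightarrow> 'a \<Rightarrow> 'a cotree" where
  "star_comp vs f x = (let L = filter (\<lambda>y. y \<noteq> x \<and> f y = x) vs in
     if L = [] then Leaf x else Node True [Leaf x, Node False (map Leaf L)])"

definition star_tree :: "'a list \<Rightarrow> ('a \<Rightarrow> 'a) \<Rightarrow> 'a cotree" where
  "star_tree vs f = Node False (map (star_comp vs f) (filter (\<lambda>x. f x = x) vs))"

lemma leaf_list_Leaf_map: "concat (map (leaf_list \<circ> Leaf) L) = L"
  by (induction L) auto

lemma leaf_list_star_comp:
  "leaf_list (star_comp vs f x) = x # filter (\<lambda>y. y \<noteq> x \<and> f y = x) vs"
  by (auto simp: star_comp_def Let_def leaf_list_Leaf_map)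

lemma leaves_star_comp:
  "leaves (star_comp vs f x) = insert x {y \<in> set vs. y \<noteq> x \<and> f y = x}"
  by (simp add: leaves_eq_leaf_list leaf_list_star_comp)

lemma leaves_star_tree:
  assumes "star_map (set vs) f"
  shows "leaves (star_tree vs f) = set vs"
proof
  show "leaves (star_tree vs f) \<subseteq> set vs"
    by (auto simp: star_tree_def leaves_star_comp)
  show "set vs \<subseteq> leaves (star_tree vs f)"
  proof
    fix x assume "x \<in> set vs"
    then have "f x \<in> set (filter (\<lambda>x. f x = x) vs)" "x \<in> leaves (star_comp vs f (f x))"
      using assms by (auto simp: star_map_def leaves_star_comp)
    then show "x \<in> leaves (star_tree vs f)" unfolding star_tree_def by fastforce
  qed
qed

lemma distinct_star_tree:
  assumes "distinct vs"
  shows "distinct (leaf_list (star_tree vs f))"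
proof -
  let ?g = "leaf_list \<circ> star_comp vs f" and ?rs = "filter (\<lambda>x. f x = x) vs"
  have g: "?g x = x # filter (\<lambda>y. y \<noteq> x \<and> f y = x) vs" for x
    by (simp add: leaf_list_star_comp)
  have fg: "f z = x" if "f x = x" "z \<in> set (?g x)" for x z
    using that by (auto simp: leaf_list_star_comp)
  show ?thesis
    unfolding star_tree_def leaf_list.simps map_map
  proof (rule distinct_concat)
    show "distinct (map ?g ?rs)"
      using assms by (simp add: distinct_map inj_on_def leaf_list_star_comp)
  next
    fix ys assume "ys \<in> set (map ?g ?rs)"
    then obtain x where "ys = ?g x" by auto
    then show "distinct ys" using assms by (simp add: g del: comp_apply)
  next
    fix ys zs assume ys: "ys \<in> set (map ?g ?rs)" and zs: "zs \<in> set (map ?g ?rs)" and ne: "ys \<noteq> zs"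
    obtain x where x: "ys = ?g x" "f x = x" using ys by auto
    obtain y where y: "zs = ?g y" "f y = y" using zs by auto
    have "z \<notin> set zs" if "z \<in> set ys" for z
      using fg[OF x(2), of z] fg[OF y(2), of z] that ne unfolding x(1) y(1) by blast
    then show "set ys \<inter> set zs = {}" by blast
  qed
qed

lemma cotree_of_star_tree:
  assumes vs: "distinct vs" "vs \<noteq> []" and f: "star_map (set vs) f"
  shows "cotree_of (set vs) (star_edges (set vs) f) (star_tree vs f)"
  unfolding cotree_of_def cotree_on_def
proof (intro conjI ballI impI allI)
  let ?T = "star_tree vs f" and ?ts = "map (star_comp vs f) (filter (\<lambda>x. f x = x) vs)"
  show "leaves ?T = set vs" by (rule leaves_star_tree[OF f])
  show "distinct (leaf_list ?T)" by (rule distinct_star_tree[OF vs(1)])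
  show "Node b [] \<notin> subtrees ?T" for b
  proof -
    have "f (hd vs) \<in> set vs" "f (f (hd vs)) = f (hd vs)"
      using f vs(2) by (auto simp: star_map_def)
    then have "filter (\<lambda>x. f x = x) vs \<noteq> []" by (auto simp: filter_empty_conv)
    then show ?thesis by (auto simp: star_tree_def star_comp_def Let_def)
  qed
  fix x y assume xy: "x \<in> set vs" "y \<in> set vs" "x \<noteq> y"
  have edge: "{x, y} \<in> star_edges (set vs) f \<longleftrightarrow> f x = y \<or> f y = x"
    using xy by (auto simp: star_edges_def doubleton_eq_iff)
  have own: "t = star_comp vs f (f z)" if "t \<in> set ?ts" "z \<in> leaves t" for t z
    using that by (auto simp: leaves_star_comp)
  have fx: "f x \<in> set vs" "f (f x) = f x" "f y \<in> set vs" "f (f y) = f y"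
    using f xy by (auto simp: star_map_def)
  show "{x, y} \<in> star_edges (set vs) f \<longleftrightarrow> label (lca ?T x y)"
  proof (cases "f x = f y")
    case False
    have "is_lca ?T x y ?T"
      unfolding star_tree_def
    proof (rule is_lca_root)
      fix t assume t: "t \<in> set ?ts" "x \<in> leaves t" "y \<in> leaves t"
      then have "leaf_list (star_comp vs f (f x)) = leaf_list (star_comp vs f (f y))"
        using own by metis
      then show False using False by (simp add: leaf_list_star_comp)
    qed (use leaves_star_tree[OF f] xy in \<open>simp_all add: star_tree_def\<close>)
    then have "lca ?T x y = ?T" by (rule lca_eqI)
    then show ?thesis using False edge fx by (auto simp: star_tree_def)
  next
    case True
    define r where "r = f x"
    have r: "f x = r" "f y = r" "f r = r" "r \<in> set vs" using True fx by (simp_all add: r_def)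
    define L where "L = filter (\<lambda>z. z \<noteq> r \<and> f z = r) vs"
    have L: "set L = {z \<in> set vs. z \<noteq> r \<and> f z = r}" by (auto simp: L_def)
    have mem: "x \<in> set L \<longleftrightarrow> x \<noteq> r" "y \<in> set L \<longleftrightarrow> y \<noteq> r" "r \<notin> set L"
      unfolding L using xy r by auto
    have "L \<noteq> []" using mem xy(3) by auto
    then have comp: "star_comp vs f r = Node True [Leaf r, Node False (map Leaf L)]"
      by (simp add: star_comp_def Let_def L_def)
    have up: "lca ?T x y = s" if "is_lca (star_comp vs f r) x y s" for s
      by (rule lca_eqI, unfold star_tree_def, rule is_lca_child[OF that])
        (use r own[of _ x] in auto)
    show ?thesis
    proof (cases "x = r \<or> y = r")
      case root: True
      have "is_lca (star_comp vs f r) x y (star_comp vs f r)"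
        unfolding comp
      proof (rule is_lca_root)
        fix t assume "t \<in> set [Leaf r, Node False (map Leaf L)]" "x \<in> leaves t" "y \<in> leaves t"
        then have "x = r \<and> y = r \<or> x \<in> set L \<and> y \<in> set L" by auto
        then show False using xy(3) root mem by blast
      qed (use mem in simp_all)
      then have "lca ?T x y = star_comp vs f r" by (rule up)
      moreover have "f x = y \<or> f y = x" using root r by auto
      ultimately show ?thesis using edge comp by simp
    next
      case leaf: False
      have "is_lca (Node False (map Leaf L)) x y (Node False (map Leaf L))"
        by (rule is_lca_root) (use xy(3) leaf mem in \<open>auto simp: image_iff\<close>)
      then have "is_lca (star_comp vs f r) x y (Node False (map Leaf L))"
        unfolding comp by (rule is_lca_child) (use leaf in \<open>auto simp: image_iff\<close>)
      then have "lca ?T x y = Node False (map Leaf L)" by (rule up)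
      moreover have "\<not> (f x = y \<or> f y = x)" using leaf r by auto
      ultimately show ?thesis using edge by simp
    qed
  qed
qed

section \<open>Decomposing arbitrary graphs\<close>

lemma degree_edge_set:
  assumes "distinct (map (\<lambda>(u, v). {u, v}) es)"
  shows "degree (edge_set es) x = list_degree es x"
proof -
  let ?g = "\<lambda>(u, v). {u, v} :: 'a set" and ?es = "filter (\<lambda>e. x = fst e \<or> x = snd e) es"
  have "{e \<in> edge_set es. x \<in> e} = ?g ` set ?es"
    unfolding edge_set_def by auto
  moreover have "inj_on ?g (set ?es)" "distinct ?es"
    using assms by (auto simp: distinct_map intro: inj_on_subset)
  ultimately show ?thesis
    by (simp add: degree_def list_degree_def card_image distinct_card del: set_filter)
qed

lemma list_degree_outside: "edges_within V es \<Longrightarrow> x \<notin> V \<Longrightarrow> list_degree es x = 0"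
  by (auto simp: list_degree_def edges_within_def filter_empty_conv)

lemma list_degree_le_max_degree:
  assumes "distinct (map (\<lambda>(u, v). {u, v}) es)" "finite V" "edges_within V es"
  shows "list_degree es x \<le> max_degree V (edge_set es)"
proof (cases "x \<in> V")
  case True
  then show ?thesis
    unfolding degree_edge_set[OF assms(1), symmetric] max_degree_def
    using assms(2) by (intro Max_ge) auto
qed (use list_degree_outside[OF assms(3)] in simp)

lemma simple_graph_edge_list:
  assumes "simple_graph V E"
  obtains es where "edge_set es = E" "edges_within V es" "distinct (map (\<lambda>(u, v). {u, v}) es)"
proof -
  have E: "e \<subseteq> V \<and> (\<exists>u v. e = {u, v} \<and> u \<noteq> v)" if "e \<in> E" for e
    using assms that unfolding simple_graph_def by (auto simp: card_2_iff)
  have "finite E"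
    by (rule finite_subset[of _ "Pow V"]) (use assms E in \<open>auto simp: simple_graph_def\<close>)
  then obtain Es where Es: "set Es = E" "distinct Es" using finite_distinct_list by blast
  define g where "g e = (SOME p. e = {fst p, snd p} \<and> fst p \<noteq> snd p)" for e :: "'a set"
  have g: "e = {fst (g e), snd (g e)} \<and> fst (g e) \<noteq> snd (g e)" if "e \<in> E" for e
    unfolding g_def using E[OF that] by (intro someI_ex[where P = "\<lambda>p. e = {fst p, snd p} \<and> fst p \<noteq> snd p"]) auto
  have "map (\<lambda>(u, v). {u, v}) (map g Es) = map id Es"
    unfolding map_map using g Es(1) by (intro map_cong) (auto simp: case_prod_beta)
  then have 1: "map (\<lambda>(u, v). {u, v}) (map g Es) = Es" by simp
  show thesis
  proof (rule that)
    show "distinct (map (\<lambda>(u, v). {u, v}) (map g Es))" using 1 Es by simp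
    show "edge_set (map g Es) = E" unfolding edge_set_def using arg_cong[OF 1, of set] Es by (simp add: image_image)
    show "edges_within V (map g Es)"
      unfolding edges_within_def
    proof
      fix p assume "p \<in> set (map g Es)"
      then obtain e where "e \<in> E" "p = g e" using Es by auto
      then show "case p of (u, v) \<Rightarrow> u \<in> V \<and> v \<in> V \<and> u \<noteq> v"
        using g[of e] E[of e] by (auto simp: case_prod_beta)
    qed
  qed
qed

lemma star_forest_decomposition:
  assumes "finite V" "edges_within V R" "\<And>x. list_degree R x \<le> D"
  obtains fs where "length fs = D" "\<forall>f\<in>set fs. star_map V f"
    "edge_set R = (\<Union>f\<in>set fs. star_edges V f)"
proof -
  have "\<exists>fs. length fs = D \<and> (\<forall>f\<in>set fs. star_map V f) \<and>
      edge_set R = (\<Union>f\<in>set fs. star_edges V f)"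
    using assms(2,3)
  proof (induction D arbitrary: R)
    case 0
    have "R = []"
    proof (cases R)
      case (Cons e R')
      then show ?thesis using 0(2)[of "fst e"] by simp
    qed
    then show ?case by (simp add: edge_set_def)
  next
    case (Suc D)
    obtain d f F S where c: "cover R R = (d, f, F, S)" by (rule prod_cases4)
    note star = cover_star_forest[OF Suc.prems(1) assms(1) c]
    have "list_degree S x \<le> D" for x
      using star(5)[of x] Suc.prems(2)[of x] by linarith
    moreover have "edges_within V S"
      using Suc.prems(1) star(3) by (auto simp: edges_within_def)
    ultimately obtain fs where fs: "length fs = D" "\<forall>f\<in>set fs. star_map V f"
        "edge_set S = (\<Union>f\<in>set fs. star_edges V f)"
      using Suc.IH by blast
    have "edge_set R = edge_set F \<union> edge_set S"
      unfolding edge_set_def star(3)[symmetric] by blast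
    then show ?case using fs star(1,2) by (intro exI[of _ "f # fs"]) simp
  qed
  then show thesis using that by blast
qed

lemma graph_star_forests:
  assumes "simple_graph V E"
  obtains fs where "length fs = max_degree V E + 1" "\<forall>f\<in>set fs. star_map V f"
    "E = (\<Union>f\<in>set fs. star_edges V f)"
proof -
  obtain es where es: "edge_set es = E" "edges_within V es" "distinct (map (\<lambda>(u, v). {u, v}) es)"
    by (rule simple_graph_edge_list[OF assms])
  have V: "finite V" using assms by (simp add: simple_graph_def)
  have "list_degree es x \<le> max_degree V E + 1" for x
    using list_degree_le_max_degree[OF es(3) V es(2), of x] es(1) by simp
  then show thesis
    using star_forest_decomposition[OF V es(2)] that es(1) by metis
qed

lemma graph_cograph_decomposition:
  assumes "simple_graph V E"
  shows "\<exists>k Es. 1 \<le> k \<and> k \<le> max_degree V E + 1 \<and> cograph_decomposition V E k Es"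
proof -
  obtain fs where fs: "length fs = max_degree V E + 1" "\<forall>f\<in>set fs. star_map V f"
    "E = (\<Union>f\<in>set fs. star_edges V f)" by (rule graph_star_forests[OF assms])
  have "cograph_decomposition V E (max_degree V E + 1) (map (star_edges V) fs)"
    unfolding cograph_decomposition_def
    using fs assms cograph_star_edges[of V] by (auto simp: simple_graph_def)
  then show ?thesis by (intro exI[of _ "max_degree V E + 1"] exI conjI) auto
qed

lemma graph_represented_by_cotrees:
  assumes "simple_graph V E"
  shows "\<exists>TT. finite TT \<and> card TT \<le> max_degree V E + 1 \<and> represented_by V E TT"
proof (cases "V = {}")
  case True
  have "E = {}"
  proof (rule ccontr)
    assume "E \<noteq> {}"
    then obtain e where "e \<in> E" by blast
    then have "e \<subseteq> {}" "card e = 2" using assms True by (auto simp: simple_graph_def)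
    then show False by simp
  qed
  then show ?thesis by (intro exI[of _ "{}"]) (simp add: represented_by_def)
next
  case False
  obtain fs where fs: "length fs = max_degree V E + 1" "\<forall>f\<in>set fs. star_map V f"
    "E = (\<Union>f\<in>set fs. star_edges V f)" by (rule graph_star_forests[OF assms])
  obtain vs where vs: "set vs = V" "distinct vs"
    using assms finite_distinct_list[of V] by (auto simp: simple_graph_def)
  let ?TT = "set (map (star_tree vs) fs)"
  have cot: "cotree_of V (star_edges V f) (star_tree vs f)" if "f \<in> set fs" for f
    using cotree_of_star_tree[of vs f] vs fs(2) that False by auto
  have "represented_by V E ?TT"
    unfolding represented_by_def
  proof (intro conjI ballI allI impI)
    fix T assume "T \<in> ?TT"
    then obtain f where "f \<in> set fs" "T = star_tree vs f" by auto
    moreover from this have "star_edges V f \<subseteq> E" unfolding fs(3) by blast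
    ultimately show "\<exists>F\<subseteq>E. cotree_of V F T" using cot by blast
  next
    fix x y assume xy: "{x, y} \<in> E"
    then have "{x, y} \<subseteq> V" "card {x, y} = 2" using assms unfolding simple_graph_def by blast+
    then have "x \<in> V" "y \<in> V" "x \<noteq> y" by auto
    moreover obtain f where f: "f \<in> set fs" "{x, y} \<in> star_edges V f"
      using xy unfolding fs(3) by blast
    ultimately have "label (lca (star_tree vs f) x y)"
      using cot[OF f(1)] unfolding cotree_of_def by blast
    then show "\<exists>T\<in>?TT. label (lca T x y)" using \<open>f \<in> set fs\<close> by auto
  qed
  moreover have "card ?TT \<le> max_degree V E + 1" using fs(1) card_length[of "map (star_tree vs) fs"] by simp
  ultimately show ?thesis by blast
qed

section \<open>Timed total correctness\<close>

definition runs :: "com \<Rightarrow> state \<Rightarrow> nat \<Rightarrow> (state \<Rightarrow> bool) \<Rightarrow> bool" where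
  "runs P s T Q \<longleftrightarrow> (\<exists>t s'. exec P s t s' \<and> t \<le> T \<and> Q s')"

lemma runs_mono: "runs P s T Q \<Longrightarrow> T \<le> T' \<Longrightarrow> (\<And>s'. Q s' \<Longrightarrow> Q' s') \<Longrightarrow> runs P s T' Q'"
  unfolding runs_def by (meson order_trans)

lemma runs_Seq:
  assumes "runs P s T Q" "\<And>s'. Q s' \<Longrightarrow> runs P' s' T' Q'"
  shows "runs (Seq P P') s (T + T') Q'"
proof -
  obtain t s' where 1: "exec P s t s'" "t \<le> T" "Q s'" using assms(1) by (auto simp: runs_def)
  obtain t' s'' where 2: "exec P' s' t' s''" "t' \<le> T'" "Q' s''"
    using assms(2)[OF 1(3)] by (auto simp: runs_def)
  show ?thesis
    unfolding runs_def using exec.Seq[OF 1(1) 2(1)] 1 2 by (meson add_mono)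
qed

lemma runs_If:
  assumes "bval b s \<Longrightarrow> runs P s T Q" "\<not> bval b s \<Longrightarrow> runs P' s T Q"
  shows "runs (If b P P') s (1 + T) Q"
proof (cases "bval b s")
  case True
  then obtain t s' where 1: "exec P s t s'" "t \<le> T" "Q s'" using assms(1) by (auto simp: runs_def)
  show ?thesis
    unfolding runs_def using exec.IfTrue[OF True 1(1)] 1 by (meson add_left_mono)
next
  case False
  then obtain t s' where 1: "exec P' s t s'" "t \<le> T" "Q s'" using assms(2) by (auto simp: runs_def)
  show ?thesis
    unfolding runs_def using exec.IfFalse[OF False 1(1)] 1 by (meson add_left_mono)
qed

text \<open>The remaining time budget in the invariant doubles as the termination measure.\<close>

lemma runs_While:
  assumes step: "\<And>s T. I s T \<Longrightarrow> bval b s \<Longrightarrow>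
      \<exists>T1 T2. 1 + T1 + T2 \<le> T \<and> runs P s T1 (\<lambda>s'. I s' T2)"
    and exit: "\<And>s T. I s T \<Longrightarrow> \<not> bval b s \<Longrightarrow> 1 \<le> T \<and> Q s"
    and init: "I s T"
  shows "runs (While b P) s T Q"
  using init
proof (induction T arbitrary: s rule: less_induct)
  case (less T)
  show ?case
  proof (cases "bval b s")
    case True
    then obtain T1 T2 where T: "1 + T1 + T2 \<le> T" "runs P s T1 (\<lambda>s'. I s' T2)"
      using step[OF less.prems] by blast
    then obtain t1 s' where 1: "exec P s t1 s'" "t1 \<le> T1" "I s' T2" by (auto simp: runs_def)
    obtain t2 s'' where 2: "exec (While b P) s' t2 s''" "t2 \<le> T2" "Q s''"
      using less.IH[OF _ 1(3)] T(1) by (auto simp: runs_def)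
    have "1 + t1 + t2 \<le> T" using 1 2 T by linarith
    then show ?thesis unfolding runs_def using exec.WhileTrue[OF True 1(1) 2(1)] 2(3) by blast
  next
    case False
    then show ?thesis unfolding runs_def using exit[OF less.prems] exec.WhileFalse by blast
  qed
qed

fun loop_free :: "com \<Rightarrow> bool" where
  "loop_free (Seq P Q) \<longleftrightarrow> loop_free P \<and> loop_free Q"
| "loop_free (If b P Q) \<longleftrightarrow> loop_free P \<and> loop_free Q"
| "loop_free (While b P) \<longleftrightarrow> False"
| "loop_free P \<longleftrightarrow> True"

text \<open>\<open>final\<close> and \<open>cost\<close> are meaningful for loop-free programs only.\<close>

fun final :: "com \<Rightarrow> state \<Rightarrow> state" where
  "final (Write x a b) s = s(x := (s x)(aval a s := aval b s))"
| "final (Seq P Q) s = final Q (final P s)"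
| "final (If b P Q) s = (if bval b s then final P s else final Q s)"
| "final P s = s"

fun cost :: "com \<Rightarrow> nat" where
  "cost (Seq P Q) = cost P + cost Q"
| "cost (If b P Q) = 1 + max (cost P) (cost Q)"
| "cost P = 1"

lemma exec_loop_free: "loop_free P \<Longrightarrow> \<exists>t \<le> cost P. exec P s t (final P s)"
proof (induction P arbitrary: s)
  case (Seq P Q)
  then obtain t t' where "t \<le> cost P" "exec P s t (final P s)"
    "t' \<le> cost Q" "exec Q (final P s) t' (final Q (final P s))"
    by (metis loop_free.simps(1))
  then show ?case by (intro exI[of _ "t + t'"]) (auto intro: exec.Seq)
next
  case (If b P Q)
  then obtain t t' where "t \<le> cost P" "exec P s t (final P s)" "t' \<le> cost Q" "exec Q s t' (final Q s)"
    by (metis loop_free.simps(2))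
  then show ?case
    by (cases "bval b s") (auto simp: le_max_iff_disj intro: exI[of _ "1 + t"] exI[of _ "1 + t'"]
      dest: exec.IfTrue[of b s P t _ Q] exec.IfFalse[of b s Q t' _ P])
qed (auto intro!: exI[of _ "Suc 0"] exec.Skip[simplified] exec.Write[simplified])

lemma runs_loop_free: "loop_free P \<Longrightarrow> Q (final P s) \<Longrightarrow> cost P \<le> T \<Longrightarrow> runs P s T Q"
  unfolding runs_def by (meson exec_loop_free order_trans)

text \<open>Scalar variables live at index 0 of their array.\<close>

abbreviation Var :: "vname \<Rightarrow> aexp" where "Var x \<equiv> Read x (N 0)"
abbreviation Assign :: "vname \<Rightarrow> aexp \<Rightarrow> com" where "Assign x a \<equiv> Write x (N 0) a"
abbreviation Incr :: "vname \<Rightarrow> com" where "Incr x \<equiv> Assign x (Plus (Var x) (N 1))"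
abbreviation Equal :: "aexp \<Rightarrow> aexp \<Rightarrow> bexp" where
  "Equal a b \<equiv> And (Not (Less a b)) (Not (Less b a))"

definition For :: "vname \<Rightarrow> vname \<Rightarrow> com \<Rightarrow> com" where
  "For x y P = Seq (Assign x (N 0)) (While (Less (Var x) (Var y)) (Seq P (Incr x)))"

lemma runs_For:
  assumes init: "I 0 (s(x := (s x)(0 := 0)))"
    and bounds: "\<And>k s. k \<le> n \<Longrightarrow> I k s \<Longrightarrow> s x 0 = k \<and> s y 0 = n"
    and step: "\<And>k s. k < n \<Longrightarrow> I k s \<Longrightarrow>
      runs P s (T k) (\<lambda>s'. I (Suc k) (s'(x := (s' x)(0 := Suc (s' x 0)))))"
  shows "runs (For x y P) s (2 + (\<Sum>k<n. T k + 2)) (I n)"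
proof -
  define J where "J s \<tau> \<longleftrightarrow> (\<exists>k\<le>n. I k s \<and> 1 + (\<Sum>k=k..<n. T k + 2) \<le> \<tau>)" for s \<tau>
  have loop: "runs (While (Less (Var x) (Var y)) (Seq P (Incr x))) s' (1 + (\<Sum>k<n. T k + 2)) (I n)"
    if "I 0 s'" for s'
  proof (rule runs_While[where I = J])
    show "J s' (1 + (\<Sum>k<n. T k + 2))"
      using that by (auto simp: J_def lessThan_atLeast0 intro!: exI[of _ 0])
  next
    fix s \<tau> assume "J s \<tau>" and b: "bval (Less (Var x) (Var y)) s"
    then obtain k where k: "k \<le> n" "I k s" "1 + (\<Sum>k=k..<n. T k + 2) \<le> \<tau>" by (auto simp: J_def)
    then have "k < n" using b bounds[of k s] by simp
    have body: "runs (Seq P (Incr x)) s (T k + 1) (\<lambda>s'. J s' (1 + (\<Sum>k=Suc k..<n. T k + 2)))"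
      using step[OF \<open>k < n\<close> k(2)]
      by (rule runs_Seq, intro runs_loop_free) (use \<open>k < n\<close> in \<open>auto simp: J_def intro!: exI[of _ "Suc k"]\<close>)
    have "1 + (T k + 1) + (1 + (\<Sum>k=Suc k..<n. T k + 2)) \<le> \<tau>"
      using k(3) \<open>k < n\<close> by (simp add: sum.atLeast_Suc_lessThan)
    then show "\<exists>T1 T2. 1 + T1 + T2 \<le> \<tau> \<and> runs (Seq P (Incr x)) s T1 (\<lambda>s'. J s' T2)"
      using body by blast
  next
    fix s \<tau> assume "J s \<tau>" and b: "\<not> bval (Less (Var x) (Var y)) s"
    then obtain k where k: "k \<le> n" "I k s" "1 + (\<Sum>k=k..<n. T k + 2) \<le> \<tau>" by (auto simp: J_def)
    then have "k = n" using b bounds[of k s] by simp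
    then show "1 \<le> \<tau> \<and> I n s" using k by simp
  qed
  have "runs (For x y P) s (1 + (1 + (\<Sum>k<n. T k + 2))) (I n)"
    unfolding For_def
    by (rule runs_Seq[OF runs_loop_free[where Q = "I 0"] loop]) (use init in auto)
  then show ?thesis by (simp add: numeral_2_eq_2)
qed

definition agree :: "vname set \<Rightarrow> state \<Rightarrow> state \<Rightarrow> bool" where
  "agree X s s' \<longleftrightarrow> (\<forall>x. x \<notin> X \<longrightarrow> s x = s' x)"

lemma agree_refl [simp]: "agree X s s"
  by (simp add: agree_def)

lemma agree_upd: "agree X s s' \<Longrightarrow> x \<in> X \<Longrightarrow> agree X (s(x := a)) s'"
  by (auto simp: agree_def)

lemma agreeD: "agree X s s' \<Longrightarrow> x \<notin> X \<Longrightarrow> s x = s' x"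
  by (simp add: agree_def)

section \<open>The program\<close>

text \<open>Array \<open>in\<close> holds the \<open>r\<close> edges still to be covered, compacted in place from index 2 on;
  \<open>d\<close> and \<open>f\<close> are the components of \<open>cover_step\<close>. Edge lists are appended to \<open>out\<close> at \<open>p\<close>;
  the cotrees are collected on \<open>t\<close> (with end marker \<open>q\<close>) and copied behind them at the end.
  \<open>k\<close> counts the rounds and \<open>g\<close> is the loop guard, initially 1 so that edgeless graphs
  also get one part.\<close>

definition edges_at :: "state \<Rightarrow> vname \<Rightarrow> nat \<Rightarrow> (nat \<times> nat) list \<Rightarrow> bool" where
  "edges_at s x b es \<longleftrightarrow> (\<forall>i<length es. s x (b + (i + i)) = fst (es ! i) \<and>
     s x (Suc b + (i + i)) = snd (es ! i))"

definition init_arrays :: com where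
  "init_arrays = For ''i'' ''n'' (Seq (Write ''d'' (Var ''i'') (N 0)) (Write ''f'' (Var ''i'') (Var ''i'')))"

lemma runs_init_arrays:
  assumes "s ''n'' 0 = n"
  shows "runs init_arrays s (2 + 4 * n)
    (\<lambda>s'. agree {''i'', ''d'', ''f''} s' s \<and> (\<forall>x<n. s' ''d'' x = 0 \<and> s' ''f'' x = x))"
proof -
  let ?I = "\<lambda>k s'. s' ''i'' 0 = k \<and> agree {''i'', ''d'', ''f''} s' s \<and>
    (\<forall>x<k. s' ''d'' x = 0 \<and> s' ''f'' x = x)"
  have "runs init_arrays s (2 + (\<Sum>k<n. 2 + 2)) (?I n)"
    unfolding init_arrays_def
  proof (rule runs_For[where I = ?I])
    show "s' ''i'' 0 = k \<and> s' ''n'' 0 = n" if "?I k s'" for k s'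
      using that assms by (auto dest: agreeD[where x = "''n''"])
    show "runs (Seq (Write ''d'' (Var ''i'') (N 0)) (Write ''f'' (Var ''i'') (Var ''i''))) s' 2
        (\<lambda>s'. ?I (Suc k) (s'(''i'' := (s' ''i'')(0 := Suc (s' ''i'' 0)))))" if "?I k s'" for k s'
      by (rule runs_loop_free) (use that in \<open>auto simp: less_Suc_eq agree_upd\<close>)
  qed (auto simp: agree_upd)
  then show ?thesis by (rule runs_mono) auto
qed

abbreviation fetch :: com where
  "fetch \<equiv> Seq (Assign ''u'' (Read ''in'' (Plus (N 2) (Plus (Var ''i'') (Var ''i'')))))
    (Assign ''v'' (Read ''in'' (Plus (N 3) (Plus (Var ''i'') (Var ''i'')))))"

abbreviation bump :: "vname \<Rightarrow> com" where
  "bump x \<equiv> Write ''d'' (Var x) (Plus (Read ''d'' (Var x)) (N 1))"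

definition count_degrees :: com where
  "count_degrees = For ''i'' ''r'' (Seq fetch (Seq (bump ''u'') (bump ''v'')))"

lemma runs_count_degrees:
  assumes R: "edges_within {..<n} R" "s ''r'' 0 = length R" "edges_at s ''in'' 2 R"
    and d: "\<forall>x<n. s ''d'' x = 0"
  shows "runs count_degrees s (2 + 6 * length R)
    (\<lambda>s'. agree {''i'', ''u'', ''v'', ''d''} s' s \<and> (\<forall>x<n. s' ''d'' x = list_degree R x))"
proof -
  let ?X = "{''i'', ''u'', ''v'', ''d''}"
  let ?I = "\<lambda>k s'. s' ''i'' 0 = k \<and> agree ?X s' s \<and> (\<forall>x<n. s' ''d'' x = list_degree (take k R) x)"
  have "runs count_degrees s (2 + (\<Sum>k<length R. 4 + 2)) (?I (length R))"
    unfolding count_degrees_def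
  proof (rule runs_For[where I = ?I])
    show "s' ''i'' 0 = k \<and> s' ''r'' 0 = length R" if "?I k s'" for k s'
      using that R by (auto dest: agreeD[where x = "''r''"])
    show "runs (Seq fetch (Seq (bump ''u'') (bump ''v''))) s' 4
        (\<lambda>s'. ?I (Suc k) (s'(''i'' := (s' ''i'')(0 := Suc (s' ''i'' 0)))))"
      if k: "k < length R" and I: "?I k s'" for k s'
    proof -
      obtain u v where uv: "R ! k = (u, v)" by force
      have "(u, v) \<in> set R" using k uv nth_mem by fastforce
      then have "u < n" "v < n" "u \<noteq> v" using R(1) by (auto simp: edges_within_def)
      moreover have "s' ''in'' (2 + (k + k)) = u" "s' ''in'' (3 + (k + k)) = v"
        using I R(3) k uv by (auto simp: edges_at_def dest!: agreeD[where x = "''in''"])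
      ultimately show ?thesis
        by (intro runs_loop_free) (use I k uv in \<open>auto simp: take_Suc_conv_app_nth agree_upd\<close>)
    qed
  qed (use d in \<open>auto simp: agree_upd\<close>)
  then show ?thesis by (rule runs_mono) auto
qed

abbreviation keep :: com where
  "keep \<equiv> Seq (Write ''out'' (Plus (Plus (Var ''p'') (N 1)) (Plus (Var ''c'') (Var ''c''))) (Var ''u''))
    (Seq (Write ''out'' (Plus (Plus (Var ''p'') (N 2)) (Plus (Var ''c'') (Var ''c''))) (Var ''v''))
    (Incr ''c''))"

abbreviation lower :: "vname \<Rightarrow> com" where
  "lower x \<equiv> Write ''d'' (Var x) (Minus (Read ''d'' (Var x)) (N 1))"

abbreviation postpone :: com where
  "postpone \<equiv> Seq (lower ''u'') (Seq (lower ''v'')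
    (Seq (Write ''in'' (Plus (N 2) (Plus (Var ''j'') (Var ''j''))) (Var ''u''))
    (Seq (Write ''in'' (Plus (N 3) (Plus (Var ''j'') (Var ''j''))) (Var ''v''))
    (Incr ''j''))))"

abbreviation cover_body :: com where
  "cover_body \<equiv> Seq fetch
    (If (Less (Read ''d'' (Var ''u'')) (N 2)) (Seq keep (Write ''f'' (Var ''u'') (Var ''v'')))
    (If (Less (Read ''d'' (Var ''v'')) (N 2)) (Seq keep (Write ''f'' (Var ''v'') (Var ''u'')))
    postpone))"

definition cover_loop :: com where
  "cover_loop = Seq (Seq (Assign ''c'' (N 0)) (Assign ''j'' (N 0))) (For ''i'' ''r'' cover_body)"

abbreviation "cover_vars \<equiv> {''i'', ''u'', ''v'', ''d'', ''f'', ''in'', ''out'', ''c'', ''j''}"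

definition cover_state :: "nat \<Rightarrow> (nat \<times> nat) list \<Rightarrow> nat \<Rightarrow> nat \<Rightarrow>
    (nat \<Rightarrow> nat) \<times> (nat \<Rightarrow> nat) \<times> (nat \<times> nat) list \<times> (nat \<times> nat) list \<Rightarrow> state \<Rightarrow> bool" where
  "cover_state n R p k c s \<longleftrightarrow> (case c of (d, f, F, S) \<Rightarrow>
    (\<forall>x<n. s ''d'' x = d x \<and> s ''f'' x = f x) \<and>
    s ''c'' 0 = length F \<and> edges_at s ''out'' (Suc p) F \<and>
    s ''j'' 0 = length S \<and> edges_at s ''in'' 2 S \<and> length S \<le> k \<and>
    (\<forall>i. k \<le> i \<and> i < length R \<longrightarrow>
       s ''in'' (2 + (i + i)) = fst (R ! i) \<and> s ''in'' (3 + (i + i)) = snd (R ! i)))"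

lemma cover_body_correct:
  assumes c: "cover_state n R p k (d, f, F, S) s" and i: "s ''i'' 0 = k" "s ''p'' 0 = p"
    and k: "k < length R" "R ! k = (u, v)" and uv: "u < n" "v < n" "u \<noteq> v"
  shows "cover_state n R p (Suc k) (cover_step (u, v) (d, f, F, S)) (final cover_body s)"
proof -
  have e: "s ''in'' (2 + (k + k)) = u" "s ''in'' (3 + (k + k)) = v"
    using c k by (auto simp: cover_state_def)
  have df: "s ''d'' u = d u" "s ''d'' v = d v" using c uv by (auto simp: cover_state_def)
  consider (u) "d u < 2" | (v) "\<not> d u < 2" "d v < 2" | (skip) "\<not> d u < 2" "\<not> d v < 2" by blast
  then show ?thesis
  proof cases
    case u
    have "final cover_body s = s(''u'' := (s ''u'')(0 := u), ''v'' := (s ''v'')(0 := v),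
        ''out'' := (s ''out'')(Suc p + (length F + length F) := u, Suc (Suc p) + (length F + length F) := v),
        ''c'' := (s ''c'')(0 := Suc (length F)), ''f'' := (s ''f'')(u := v))"
      using c i e df u by (simp add: cover_state_def)
    then show ?thesis
      using c u by (auto simp: cover_state_def edges_at_def nth_append less_Suc_eq)
  next
    case v
    have "final cover_body s = s(''u'' := (s ''u'')(0 := u), ''v'' := (s ''v'')(0 := v),
        ''out'' := (s ''out'')(Suc p + (length F + length F) := u, Suc (Suc p) + (length F + length F) := v),
        ''c'' := (s ''c'')(0 := Suc (length F)), ''f'' := (s ''f'')(v := u))"
      using c i e df v by (simp add: cover_state_def)
    then show ?thesis
      using c v by (auto simp: cover_state_def edges_at_def nth_append less_Suc_eq)
  next
    case skip
    have "final cover_body s = s(''u'' := (s ''u'')(0 := u), ''v'' := (s ''v'')(0 := v),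
        ''d'' := (s ''d'')(u := d u - 1, v := d v - 1),
        ''in'' := (s ''in'')(2 + (length S + length S) := u, 3 + (length S + length S) := v),
        ''j'' := (s ''j'')(0 := Suc (length S)))"
      using c i e df uv skip by (simp add: cover_state_def)
    then show ?thesis
      using c skip by (auto simp: cover_state_def edges_at_def nth_append less_Suc_eq)
  qed
qed

lemma cover_body_frame:
  assumes "s ''p'' 0 = p"
  shows "agree cover_vars (final cover_body s) s" "i \<le> p \<Longrightarrow> final cover_body s ''out'' i = s ''out'' i"
  using assms by (auto simp: agree_upd)

lemma runs_cover_loop:
  assumes R: "edges_within {..<n} R" "s ''r'' 0 = length R" "edges_at s ''in'' 2 R"
    and d: "\<forall>x<n. s ''d'' x = list_degree R x \<and> s ''f'' x = x" and p: "s ''p'' 0 = p"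
  shows "runs cover_loop s (4 + 11 * length R)
    (\<lambda>s'. agree cover_vars s' s \<and> (\<forall>i\<le>p. s' ''out'' i = s ''out'' i) \<and>
      cover_state n R p (length R) (cover R R) s')"
proof -
  let ?I = "\<lambda>k s'. s' ''i'' 0 = k \<and> agree cover_vars s' s \<and> (\<forall>i\<le>p. s' ''out'' i = s ''out'' i) \<and>
    cover_state n R p k (cover R (take k R)) s'"
  let ?s = "s(''c'' := (s ''c'')(0 := 0), ''j'' := (s ''j'')(0 := 0))"
  have loop: "runs (For ''i'' ''r'' cover_body) ?s (2 + (\<Sum>k<length R. 9 + 2)) (?I (length R))"
  proof (rule runs_For[where I = ?I])
    show "s' ''i'' 0 = k \<and> s' ''r'' 0 = length R" if "?I k s'" for k s'
      using that R by (auto dest: agreeD[where x = "''r''"])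
    show "?I 0 (?s(''i'' := (?s ''i'')(0 := 0)))"
      using d R by (auto simp: agree_upd cover_state_def edges_at_def)
    show "runs cover_body s' 9 (\<lambda>s'. ?I (Suc k) (s'(''i'' := (s' ''i'')(0 := Suc (s' ''i'' 0)))))"
      if k: "k < length R" and I: "?I k s'" for k s'
    proof (rule runs_loop_free)
      obtain u v where uv: "R ! k = (u, v)" by force
      have "(u, v) \<in> set R" using k uv nth_mem by fastforce
      then have uv': "u < n" "v < n" "u \<noteq> v" using R(1) by (auto simp: edges_within_def)
      have p': "s' ''p'' 0 = p" using I p by (auto dest: agreeD[where x = "''p''"])
      obtain d f F S where c: "cover R (take k R) = (d, f, F, S)" by (rule prod_cases4)
      have "cover_state n R p (Suc k) (cover_step (u, v) (d, f, F, S)) (final cover_body s')"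
        by (rule cover_body_correct) (use I c p' k uv uv' in auto)
      moreover have "cover R (take (Suc k) R) = cover_step (u, v) (d, f, F, S)"
        using k uv c by (simp add: take_Suc_conv_app_nth)
      moreover have "agree cover_vars (final cover_body s') s"
        using cover_body_frame(1)[of s' p, OF p'] I by (simp add: agree_def)
      moreover have "\<forall>i\<le>p. final cover_body s' ''out'' i = s ''out'' i"
        using cover_body_frame(2)[of s' p, OF p'] I by simp
      moreover have "final cover_body s' ''i'' 0 = k" using I by simp
      ultimately show "?I (Suc k) ((final cover_body s')(''i'' := (final cover_body s' ''i'')
          (0 := Suc (final cover_body s' ''i'' 0))))"
        by (simp add: agree_upd cover_state_def edges_at_def del: final.simps)
    qed auto
  qed
  have "runs cover_loop s (2 + (2 + (\<Sum>k<length R. 9 + 2))) (?I (length R))"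
    unfolding cover_loop_def
    by (rule runs_Seq[OF runs_loop_free[where Q = "\<lambda>s'. s' = ?s"]]) (use loop in auto)
  then show ?thesis by (rule runs_mono) auto
qed

abbreviation emit :: "aexp \<Rightarrow> com" where
  "emit a \<equiv> Seq (Write ''t'' (Var ''q'') a) (Incr ''q'')"

definition push :: "nat \<Rightarrow> state \<Rightarrow> state" where
  "push a s = s(''t'' := (s ''t'')(s ''q'' 0 := a), ''q'' := (s ''q'')(0 := Suc (s ''q'' 0)))"

definition tape :: "state \<Rightarrow> nat list \<Rightarrow> bool" where
  "tape s xs \<longleftrightarrow> s ''q'' 0 = length xs \<and> (\<forall>i<length xs. s ''t'' i = xs ! i)"

lemma final_emit: "final (emit a) s = push (aval a s) s"
  by (simp add: push_def)

lemma push_other [simp]: "x \<noteq> ''t'' \<Longrightarrow> x \<noteq> ''q'' \<Longrightarrow> push a s x = s x"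
  by (simp add: push_def)

lemma agree_push: "agree X s s' \<Longrightarrow> {''t'', ''q''} \<subseteq> X \<Longrightarrow> agree X (push a s) s'"
  by (auto simp: agree_def push_def)

lemma tape_push: "tape s xs \<Longrightarrow> tape (push a s) (xs @ [a])"
  by (auto simp: tape_def push_def nth_append less_Suc_eq)

lemma tape_pushes:
  "tape s xs \<Longrightarrow> tape (push b (push a s)) (xs @ [a, b])"
  "tape s xs \<Longrightarrow> tape (push g (push e (push d (push c (push b (push a s)))))) (xs @ [a, b, c, d, e, g])"
  using tape_push[of "push a s" "xs @ [a]" b] tape_push[of s xs a]
    tape_push[of "push b (push a s)" "xs @ [a, b]" c]
    tape_push[of "push c (push b (push a s))" "xs @ [a, b, c]" d]
    tape_push[of "push d (push c (push b (push a s)))" "xs @ [a, b, c, d]" e]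
    tape_push[of "push e (push d (push c (push b (push a s))))" "xs @ [a, b, c, d, e]" g]
  by auto

lemma tape_upd: "x \<noteq> ''t'' \<Longrightarrow> x \<noteq> ''q'' \<Longrightarrow> tape (s(x := a)) xs \<longleftrightarrow> tape s xs"
  by (auto simp: tape_def)

abbreviation leaf_body :: com where
  "leaf_body \<equiv> If (And (Equal (Read ''f'' (Var ''y'')) (Var ''x'')) (Not (Equal (Var ''y'') (Var ''x''))))
    (Seq (emit (N 0)) (emit (Var ''y''))) Skip"

definition emit_leaves :: com where
  "emit_leaves = For ''y'' ''n'' leaf_body"

lemma runs_emit_leaves:
  assumes s: "s ''n'' 0 = n" "\<forall>y<n. s ''f'' y = f y" "s ''x'' 0 = x" and t: "tape s xs"
  shows "runs emit_leaves s (2 + 7 * n) (\<lambda>s'. agree {''y'', ''t'', ''q''} s' s \<and>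
    tape s' (xs @ concat (map (\<lambda>y. [0, y]) (filter (\<lambda>y. y \<noteq> x \<and> f y = x) [0..<n]))))"
proof -
  let ?X = "{''y'', ''t'', ''q''}"
  let ?I = "\<lambda>k s'. s' ''y'' 0 = k \<and> agree ?X s' s \<and>
    tape s' (xs @ concat (map (\<lambda>y. [0, y]) (filter (\<lambda>y. y \<noteq> x \<and> f y = x) [0..<k])))"
  have "runs emit_leaves s (2 + (\<Sum>k<n. 5 + 2)) (?I n)"
    unfolding emit_leaves_def
  proof (rule runs_For[where I = ?I])
    show "s' ''y'' 0 = k \<and> s' ''n'' 0 = n" if "?I k s'" for k s'
      using that s by (auto dest: agreeD[where x = "''n''"])
    show "?I 0 (s(''y'' := (s ''y'')(0 := 0)))" using t by (simp add: agree_upd tape_upd)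
    show "runs leaf_body s' 5 (\<lambda>s'. ?I (Suc k) (s'(''y'' := (s' ''y'')(0 := Suc (s' ''y'' 0)))))"
      if k: "k < n" and I: "?I k s'" for k s'
    proof (rule runs_loop_free)
      have fx: "s' ''f'' k = f k" "s' ''x'' 0 = x"
      proof -
        have "s' ''f'' = s ''f''" "s' ''x'' = s ''x''" using I by (simp_all add: agree_def)
        then show "s' ''f'' k = f k" "s' ''x'' 0 = x" using s k by simp_all
      qed
      have "final leaf_body s' = (if k \<noteq> x \<and> f k = x then push k (push 0 s') else s')"
        using I fx by (simp add: final_emit del: final.simps(1)) (auto simp: push_def)
      then show "?I (Suc k) ((final leaf_body s')(''y'' := (final leaf_body s' ''y'')
          (0 := Suc (final leaf_body s' ''y'' 0))))"
        using I tape_pushes(1)[where s = s' and a = 0 and b = k and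
            xs = "xs @ concat (map (\<lambda>y. [0, y]) (filter (\<lambda>y. y \<noteq> x \<and> f y = x) [0..<k]))"]
        by (auto simp: agree_upd agree_push tape_upd simp del: final.simps)
    qed auto
  qed
  then show ?thesis by (rule runs_mono) auto
qed

abbreviation comp_body :: com where
  "comp_body \<equiv> If (Equal (Read ''f'' (Var ''x'')) (Var ''x''))
    (If (Less (N 0) (Read ''d'' (Var ''x'')))
      (Seq (Seq (emit (N 2)) (Seq (emit (N 2)) (Seq (emit (N 0)) (Seq (emit (Var ''x''))
        (Seq (emit (N 1)) (emit (Read ''d'' (Var ''x'')))))))) emit_leaves)
      (Seq (emit (N 0)) (emit (Var ''x'')))) Skip"

definition emit_comps :: com where
  "emit_comps = For ''x'' ''n'' comp_body"

lemma enc_star_comp: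
  "enc_cotree (star_comp vs f x) = (let L = filter (\<lambda>y. y \<noteq> x \<and> f y = x) vs in
     if L = [] then [0, x] else [2, 2, 0, x, 1, length L] @ concat (map (\<lambda>y. [0, y]) L))"
  by (simp add: star_comp_def Let_def comp_def)

lemma runs_emit_comps:
  assumes s: "s ''n'' 0 = n" "\<forall>x<n. s ''f'' x = f x" "\<forall>x<n. s ''d'' x = d x" and t: "tape s xs"
    and d: "\<And>x. f x = x \<Longrightarrow> d x = card {y \<in> {..<n}. y \<noteq> x \<and> f y = x}"
  shows "runs emit_comps s (2 + (\<Sum>x<n. (16 + (if f x = x \<and> 0 < d x then 7 * n else 0)) + 2))
    (\<lambda>s'. agree {''x'', ''y'', ''t'', ''q''} s' s \<and>
      tape s' (xs @ concat (map enc_cotree (map (star_comp [0..<n] f) (filter (\<lambda>x. f x = x) [0..<n])))))"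
proof -
  let ?X = "{''x'', ''y'', ''t'', ''q''}"
  let ?cs = "\<lambda>k. map (star_comp [0..<n] f) (filter (\<lambda>x. f x = x) [0..<k])"
  let ?I = "\<lambda>k s'. s' ''x'' 0 = k \<and> agree ?X s' s \<and> tape s' (xs @ concat (map enc_cotree (?cs k)))"
  have "runs emit_comps s (2 + (\<Sum>x<n. (16 + (if f x = x \<and> 0 < d x then 7 * n else 0)) + 2)) (?I n)"
    unfolding emit_comps_def
  proof (rule runs_For[where I = ?I])
    show "s' ''x'' 0 = k \<and> s' ''n'' 0 = n" if "?I k s'" for k s'
      using that s by (auto dest: agreeD[where x = "''n''"])
    show "?I 0 (s(''x'' := (s ''x'')(0 := 0)))" using t by (simp add: agree_upd tape_upd)
    fix k s' assume k: "k < n" and I: "?I k s'"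
    let ?Q = "\<lambda>s'. ?I (Suc k) (s'(''x'' := (s' ''x'')(0 := Suc (s' ''x'' 0))))"
    let ?L = "filter (\<lambda>y. y \<noteq> k \<and> f y = k) [0..<n]"
    let ?ys = "xs @ concat (map enc_cotree (?cs k))"
    have fx: "s' ''f'' k = f k" "s' ''d'' k = d k" "s' ''n'' 0 = n" "\<forall>y<n. s' ''f'' y = f y"
    proof -
      have "s' ''f'' = s ''f''" "s' ''d'' = s ''d''" "s' ''n'' = s ''n''" using I by (simp_all add: agree_def)
      then show "s' ''f'' k = f k" "s' ''d'' k = d k" "s' ''n'' 0 = n" "\<forall>y<n. s' ''f'' y = f y"
        using s k by simp_all
    qed
    have dL: "d k = length ?L" if "f k = k"
    proof -
      have "length ?L = card (set ?L)" by (rule distinct_card[symmetric]) simp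
      also have "set ?L = {y \<in> {..<n}. y \<noteq> k \<and> f y = k}" by auto
      finally show ?thesis using d[OF that] by simp
    qed
    consider (star) "f k = k" "0 < d k" | (leaf) "f k = k" "d k = 0" | (skip) "f k \<noteq> k" by auto
    then show "runs comp_body s' (16 + (if f k = k \<and> 0 < d k then 7 * n else 0)) ?Q"
    proof cases
      case star
      let ?s = "push (d k) (push 1 (push k (push 0 (push 2 (push 2 s')))))"
      have "runs emit_leaves ?s (2 + 7 * n) (\<lambda>s''. agree {''y'', ''t'', ''q''} s'' ?s \<and>
          tape s'' ((?ys @ [2, 2, 0, k, 1, d k]) @ concat (map (\<lambda>y. [0, y]) ?L)))"
      proof (rule runs_emit_leaves)
        show "tape ?s (?ys @ [2, 2, 0, k, 1, d k])" by (rule tape_pushes) (use I in simp)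
      qed (use fx I in simp_all)
      then have 1: "runs emit_leaves ?s (2 + 7 * n) ?Q"
      proof (rule runs_mono)
        fix s'' assume a: "agree {''y'', ''t'', ''q''} s'' ?s \<and>
          tape s'' ((?ys @ [2, 2, 0, k, 1, d k]) @ concat (map (\<lambda>y. [0, y]) ?L))"
        have "enc_cotree (star_comp [0..<n] f k) = [2, 2, 0, k, 1, d k] @ concat (map (\<lambda>y. [0, y]) ?L)"
          using star dL by (auto simp: enc_star_comp Let_def simp del: upt_Suc)
        moreover have "s'' ''x'' 0 = k" using a I by (auto dest: agreeD[where x = "''x''"])
        moreover have "agree ?X s'' s" using a I by (auto simp: agree_def)
        ultimately show "?Q s''" using a star by (simp add: agree_upd tape_upd)
      qed simp
      have 2: "runs (Seq (emit (N 2)) (Seq (emit (N 2)) (Seq (emit (N 0)) (Seq (emit (Var ''x''))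
        (Seq (emit (N 1)) (emit (Read ''d'' (Var ''x'')))))))) s' 12 (\<lambda>s''. s'' = ?s)"
        by (rule runs_loop_free) (use I fx in \<open>simp_all add: push_def\<close>)
      have 3: "runs comp_body s' (1 + (1 + (12 + (2 + 7 * n)))) ?Q"
      proof (rule runs_If)
        show "runs (If (Less (N 0) (Read ''d'' (Var ''x''))) (Seq (Seq (emit (N 2)) (Seq (emit (N 2))
          (Seq (emit (N 0)) (Seq (emit (Var ''x'')) (Seq (emit (N 1)) (emit (Read ''d'' (Var ''x''))))))))
          emit_leaves) (Seq (emit (N 0)) (emit (Var ''x'')))) s' (1 + (12 + (2 + 7 * n))) ?Q"
        proof (rule runs_If)
          show "runs (Seq (Seq (emit (N 2)) (Seq (emit (N 2)) (Seq (emit (N 0)) (Seq (emit (Var ''x''))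
            (Seq (emit (N 1)) (emit (Read ''d'' (Var ''x'')))))))) emit_leaves) s' (12 + (2 + 7 * n)) ?Q"
            by (rule runs_Seq[OF 2]) (use 1 in simp)
        qed (use I fx star in simp)
      qed (use I fx star in simp)
      show ?thesis by (rule runs_mono[OF 3]) (use star in auto)
    next
      case leaf
      have "runs (Seq (emit (N 0)) (emit (Var ''x''))) s' 4 (\<lambda>s''. s'' = push k (push 0 s'))"
        by (rule runs_loop_free) (use I fx in \<open>simp_all add: push_def\<close>)
      then have 1: "runs (Seq (emit (N 0)) (emit (Var ''x''))) s' 4 ?Q"
      proof (rule runs_mono)
        have "?L = []" using dL leaf by simp
        then have "enc_cotree (star_comp [0..<n] f k) = [0, k]" by (simp only: enc_star_comp Let_def simp_thms if_True)
        then show "?Q s''" if "s'' = push k (push 0 s')" for s''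
          using that I leaf tape_pushes(1)[where s = s' and xs = ?ys and a = 0 and b = k] by (simp add: agree_upd agree_push tape_upd)
      qed simp
      have 3: "runs comp_body s' (1 + (1 + 4)) ?Q"
        by (intro runs_If) (use I fx leaf 1 in simp_all)
      show ?thesis by (rule runs_mono[OF 3]) (use leaf in auto)
    next
      case skip
      have 1: "runs Skip s' 1 ?Q"
        by (rule runs_loop_free) (use I skip in \<open>simp_all add: agree_upd tape_upd\<close>)
      have 3: "runs comp_body s' (1 + 1) ?Q"
        by (rule runs_If) (use I fx skip 1 in simp_all)
      show ?thesis by (rule runs_mono[OF 3]) (use skip in auto)
    qed
  qed
  then show ?thesis by (rule runs_mono) auto
qed

definition out_tape :: "state \<Rightarrow> nat list \<Rightarrow> bool" where
  "out_tape s ys \<longleftrightarrow> s ''p'' 0 = Suc (length ys) \<and> (\<forall>i<length ys. s ''out'' (Suc i) = ys ! i)"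

lemma length_flat: "length (concat (map (\<lambda>(u, v). [u, v]) es)) = length es + length es"
  by (induction es) auto

lemma edges_at_flat:
  "edges_at s x b es \<longleftrightarrow> (\<forall>i<length es + length es. s x (b + i) = concat (map (\<lambda>(u, v). [u, v]) es) ! i)"
proof (induction es arbitrary: b)
  case (Cons e es)
  obtain u v where e: "e = (u, v)" by force
  have "edges_at s x b (e # es) \<longleftrightarrow> s x b = u \<and> s x (Suc b) = v \<and> edges_at s x (Suc (Suc b)) es"
    by (simp add: edges_at_def e All_less_Suc2)
  then show ?case by (simp add: Cons e All_less_Suc2)
qed (simp add: edges_at_def)

definition close_edges :: com where
  "close_edges = Seq (Write ''out'' (Var ''p'') (Var ''c''))
    (Seq (Assign ''p'' (Plus (Plus (Var ''p'') (N 1)) (Plus (Var ''c'') (Var ''c''))))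
    (Seq (Assign ''r'' (Var ''j'')) (Seq (Assign ''g'' (Var ''j'')) (Seq (Incr ''k'')
    (Seq (emit (N 1)) (emit (Minus (Var ''n'') (Var ''c''))))))))"

definition cover_round :: com where
  "cover_round = Seq init_arrays (Seq count_degrees (Seq cover_loop (Seq close_edges emit_comps)))"

lemma enc_star_tree:
  assumes "card {x \<in> {..<n}. f x \<noteq> x} = l"
  shows "enc_cotree (star_tree [0..<n] f) =
    [1, n - l] @ concat (map enc_cotree (map (star_comp [0..<n] f) (filter (\<lambda>x. f x = x) [0..<n])))"
proof -
  have "length (filter (\<lambda>x. f x = x) [0..<n]) = card (set (filter (\<lambda>x. f x = x) [0..<n]))"
    by (rule distinct_card[symmetric]) simp
  also have "set (filter (\<lambda>x. f x = x) [0..<n]) = {..<n} - {x \<in> {..<n}. f x \<noteq> x}" by auto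
  also have "card \<dots> = n - l" using assms by (subst card_Diff_subset) auto
  finally show ?thesis by (simp add: star_tree_def)
qed

lemma card_star_centers:
  assumes "\<And>x. f x = x \<Longrightarrow> d x = card {y \<in> {..<n}. y \<noteq> x \<and> f y = x}"
  shows "card {x \<in> {..<n}. f x = x \<and> 0 < d x} \<le> card {x \<in> {..<n}. f x \<noteq> (x::nat)}"
proof (rule surj_card_le)
  show "{x \<in> {..<n}. f x = x \<and> 0 < d x} \<subseteq> f ` {x \<in> {..<n}. f x \<noteq> x}"
  proof
    fix x assume x: "x \<in> {x \<in> {..<n}. f x = x \<and> 0 < d x}"
    then have "0 < card {y \<in> {..<n}. y \<noteq> x \<and> f y = x}" using assms by auto
    then have "{y \<in> {..<n}. y \<noteq> x \<and> f y = x} \<noteq> {}" by (metis card.empty less_irrefl)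
    then show "x \<in> f ` {x \<in> {..<n}. f x \<noteq> x}" by auto
  qed
qed simp

lemma runs_cover_round:
  assumes n: "s ''n'' 0 = n" and R: "edges_within {..<n} R" "s ''r'' 0 = length R" "edges_at s ''in'' 2 R"
    and ys: "out_tape s ys" and xs: "tape s xs" and c: "cover R R = (d, f, F, S)"
  shows "runs cover_round s (50 * (n + length R + 1) + 7 * n * length F) (\<lambda>s'.
    s' ''n'' 0 = n \<and> s' ''r'' 0 = length S \<and> s' ''g'' 0 = length S \<and> s' ''k'' 0 = Suc (s ''k'' 0) \<and>
    edges_at s' ''in'' 2 S \<and> out_tape s' (ys @ enc_edges F) \<and>
    tape s' (xs @ enc_cotree (star_tree [0..<n] f)))" (is "runs _ _ ?T ?Q")
proof -
  let ?p = "Suc (length ys)"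
  note star = cover_star_forest[OF R(1) finite_lessThan c]
  let ?Q1 = "\<lambda>s'. agree {''i'', ''d'', ''f''} s' s \<and> (\<forall>x<n. s' ''d'' x = 0 \<and> s' ''f'' x = x)"
  let ?Q2 = "\<lambda>s'. agree {''i'', ''d'', ''f'', ''u'', ''v''} s' s \<and>
    (\<forall>x<n. s' ''d'' x = list_degree R x \<and> s' ''f'' x = x)"
  let ?Q3 = "\<lambda>s'. agree cover_vars s' s \<and> (\<forall>i\<le>?p. s' ''out'' i = s ''out'' i) \<and>
      cover_state n R ?p (length R) (d, f, F, S) s'"
  let ?Q4 = "\<lambda>s'. s' ''n'' 0 = n \<and> s' ''r'' 0 = length S \<and> s' ''g'' 0 = length S \<and>
    s' ''k'' 0 = Suc (s ''k'' 0) \<and> edges_at s' ''in'' 2 S \<and> out_tape s' (ys @ enc_edges F) \<and>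
    tape s' (xs @ [1, n - length F]) \<and> (\<forall>x<n. s' ''f'' x = f x) \<and> (\<forall>x<n. s' ''d'' x = d x)"
  have 1: "runs init_arrays s (2 + 4 * n) ?Q1" by (rule runs_init_arrays[of s n, OF n])
  have 2: "runs count_degrees s1 (2 + 6 * length R) ?Q2" if s1: "?Q1 s1" for s1
  proof -
    have eq: "s1 ''r'' = s ''r''" "s1 ''in'' = s ''in''" using s1 by (simp_all add: agree_def)
    have "runs count_degrees s1 (2 + 6 * length R) (\<lambda>s'. agree {''i'', ''u'', ''v'', ''d''} s' s1 \<and>
        (\<forall>x<n. s' ''d'' x = list_degree R x))"
      by (rule runs_count_degrees) (use R s1 eq in \<open>auto simp: edges_at_def\<close>)
    then show ?thesis by (rule runs_mono) (use s1 in \<open>auto simp: agree_def\<close>)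
  qed
  have 3: "runs cover_loop s2 (4 + 11 * length R) ?Q3" if s2: "?Q2 s2" for s2
  proof -
    have eq: "s2 ''r'' = s ''r''" "s2 ''in'' = s ''in''" "s2 ''p'' = s ''p''" "s2 ''out'' = s ''out''"
      using s2 by (simp_all add: agree_def)
    have "runs cover_loop s2 (4 + 11 * length R)
      (\<lambda>s'. agree cover_vars s' s2 \<and> (\<forall>i\<le>?p. s' ''out'' i = s2 ''out'' i) \<and>
        cover_state n R ?p (length R) (cover R R) s')"
      by (rule runs_cover_loop) (use R s2 eq ys in \<open>auto simp: edges_at_def out_tape_def\<close>)
    then show ?thesis by (rule runs_mono) (use s2 eq c in \<open>auto simp: agree_def\<close>)
  qed
  have 4: "runs close_edges s3 9 ?Q4" if s3: "?Q3 s3" for s3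
  proof (rule runs_loop_free)
    have eq: "s3 ''n'' = s ''n''" "s3 ''p'' = s ''p''" "s3 ''k'' = s ''k''" "s3 ''t'' = s ''t''" "s3 ''q'' = s ''q''"
      using s3 by (simp_all add: agree_def)
    let ?s = "s3(''out'' := (s3 ''out'')(?p := length F), ''p'' := (s ''p'')(0 := Suc ?p + (length F + length F)),
      ''r'' := (s3 ''r'')(0 := length S), ''g'' := (s3 ''g'')(0 := length S), ''k'' := (s ''k'')(0 := Suc (s ''k'' 0)))"
    have cs: "s3 ''c'' 0 = length F" "s3 ''j'' 0 = length S" "edges_at s3 ''out'' (Suc ?p) F"
      "edges_at s3 ''in'' 2 S" "\<forall>x<n. s3 ''f'' x = f x" "\<forall>x<n. s3 ''d'' x = d x"
      using s3 by (auto simp: cover_state_def)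
    have fin: "final close_edges s3 = push (n - length F) (push 1 ?s)"
      using eq cs ys n by (simp add: close_edges_def out_tape_def push_def)
    have "tape ?s xs" using xs eq by (simp add: tape_def)
    then have "tape (final close_edges s3) (xs @ [1, n - length F])"
      unfolding fin by (rule tape_pushes)
    moreover have "out_tape (final close_edges s3) (ys @ enc_edges F)"
    proof -
      let ?fl = "concat (map (\<lambda>(u, v). [u, v]) F)"
      have "final close_edges s3 ''out'' (Suc i) = (ys @ length F # ?fl) ! i"
        if "i < length ys + Suc (length F + length F)" for i
      proof (cases i "length ys" rule: linorder_cases)
        case less
        then show ?thesis using s3 ys by (simp add: fin out_tape_def nth_append)
      next
        case equal
        then show ?thesis by (simp add: fin nth_append)
      next
        case greater
        then obtain j where "i = Suc (length ys + j)" using less_imp_Suc_add by blast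
        then show ?thesis using cs(3) that by (simp add: fin edges_at_flat nth_append)
      qed
      then show ?thesis by (simp add: out_tape_def enc_edges_def length_flat fin)
    qed
    ultimately show "?Q4 (final close_edges s3)"
      using cs eq n by (simp add: fin edges_at_def)
  qed (simp_all add: close_edges_def)
  let ?T5 = "2 + (\<Sum>x<n. (16 + (if f x = x \<and> 0 < d x then 7 * n else 0)) + 2)"
  have 5: "runs emit_comps s4 ?T5 ?Q" if s4: "?Q4 s4" for s4
  proof -
    have "runs emit_comps s4 ?T5 (\<lambda>s'. agree {''x'', ''y'', ''t'', ''q''} s' s4 \<and>
      tape s' ((xs @ [1, n - length F]) @
        concat (map enc_cotree (map (star_comp [0..<n] f) (filter (\<lambda>x. f x = x) [0..<n])))))"
      by (rule runs_emit_comps) (use s4 star(6) in auto)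
    then show ?thesis
    proof (rule runs_mono)
      fix s' assume s': "agree {''x'', ''y'', ''t'', ''q''} s' s4 \<and>
        tape s' ((xs @ [1, n - length F]) @
          concat (map enc_cotree (map (star_comp [0..<n] f) (filter (\<lambda>x. f x = x) [0..<n]))))"
      have "s' ''n'' = s4 ''n''" "s' ''r'' = s4 ''r''" "s' ''g'' = s4 ''g''" "s' ''k'' = s4 ''k''"
        "s' ''in'' = s4 ''in''" "s' ''p'' = s4 ''p''" "s' ''out'' = s4 ''out''"
        using s' by (simp_all add: agree_def)
      then show "?Q s'"
        using s4 s' enc_star_tree[OF star(7)] by (simp add: edges_at_def out_tape_def)
    qed simp
  qed
  have "(\<Sum>x<n. (if f x = x \<and> 0 < d x then 7 * n else 0)) = 7 * n * card {x \<in> {..<n}. f x = x \<and> 0 < d x}"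
    by (simp add: sum.If_cases Int_def conj_commute)
  also have "\<dots> \<le> 7 * n * length F"
    using card_star_centers[of f d n, OF star(6)] star(7) by simp
  finally have T5: "?T5 \<le> 2 + 18 * n + 7 * n * length F"
    by (simp add: sum.distrib)
  have "runs cover_round s (2 + 4 * n + (2 + 6 * length R + (4 + 11 * length R + (9 + ?T5)))) ?Q"
    unfolding cover_round_def
    by (rule runs_Seq[OF 1], rule runs_Seq[OF 2], assumption, rule runs_Seq[OF 3], assumption,
        rule runs_Seq[OF 4], assumption, rule 5)
  then show ?thesis by (rule runs_mono) (use T5 in auto)
qed

section \<open>Correctness and running time of the program\<close>

lemma length_enc_star_comp:
  "length (enc_cotree (star_comp vs f x)) \<le> 6 * length (leaf_list (star_comp vs f x))"
proof -
  have "length (concat (map (\<lambda>y. [0, y]) L)) = 2 * length L" for L :: "nat list"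
    by (induction L) auto
  then show ?thesis by (simp add: enc_star_comp leaf_list_star_comp Let_def)
qed

lemma length_concat_map_le:
  assumes "\<And>t. t \<in> set ts \<Longrightarrow> length (g t) \<le> c * length (h t)"
  shows "length (concat (map g ts)) \<le> c * length (concat (map h ts))"
  using assms by (induction ts) (auto simp: algebra_simps intro: add_mono)

lemma length_enc_star_tree:
  assumes "star_map {..<n} f"
  shows "length (enc_cotree (star_tree [0..<n] f)) \<le> 2 + 6 * n"
proof -
  let ?T = "star_tree [0..<n] f" and ?cs = "map (star_comp [0..<n] f) (filter (\<lambda>x. f x = x) [0..<n])"
  have "set (leaf_list ?T) = {..<n}"
    using leaves_star_tree[of "[0..<n]" f] assms
    by (simp add: leaves_eq_leaf_list lessThan_atLeast0)
  then have "length (leaf_list ?T) = n"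
    using distinct_card[OF distinct_star_tree[of "[0..<n]" f]] by simp
  moreover have "length (concat (map enc_cotree ?cs)) \<le> 6 * length (concat (map leaf_list ?cs))"
    by (rule length_concat_map_le) (auto simp: length_enc_star_comp)
  ultimately show ?thesis by (simp add: star_tree_def)
qed

definition main_inv :: "nat \<Rightarrow> (nat \<times> nat) list \<Rightarrow> nat \<Rightarrow> (nat \<times> nat) list list \<Rightarrow> (nat \<Rightarrow> nat) list \<Rightarrow>
    (nat \<times> nat) list \<Rightarrow> state \<Rightarrow> bool" where
  "main_inv n es D Fs fs R s \<longleftrightarrow>
    s ''n'' 0 = n \<and> s ''r'' 0 = length R \<and> edges_at s ''in'' 2 R \<and> s ''k'' 0 = length Fs \<and>
    s ''g'' 0 = (if Fs = [] then 1 else length R) \<and>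
    out_tape s (concat (map enc_edges Fs)) \<and>
    tape s (concat (map enc_cotree (map (star_tree [0..<n]) fs))) \<and>
    edges_within {..<n} R \<and> length R \<le> length es \<and> set (concat Fs) \<union> set R = set es \<and>
    list_all2 (\<lambda>F f. star_map {..<n} f \<and> edge_set F = star_edges {..<n} f) Fs fs \<and>
    (\<forall>x. list_degree R x \<le> D - length Fs) \<and> length Fs \<le> max 1 D"

definition main_time :: "nat \<Rightarrow> nat \<Rightarrow> nat \<Rightarrow> nat \<Rightarrow> nat \<Rightarrow> nat" where
  "main_time n m D l r = 1 + (max 1 D - l) * (51 * (n + m + 1)) + 7 * n * r"

abbreviation main_loop :: com where
  "main_loop \<equiv> While (Less (N 0) (Var ''g'')) cover_round"

lemma runs_main_loop:
  assumes "main_inv n es D [] [] es s"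
  shows "runs main_loop s (main_time n (length es) D 0 (length es))
    (\<lambda>s'. \<exists>Fs fs. Fs \<noteq> [] \<and> main_inv n es D Fs fs [] s')"
proof (rule runs_While[where I = "\<lambda>s T. \<exists>Fs fs R. main_inv n es D Fs fs R s \<and>
      main_time n (length es) D (length Fs) (length R) \<le> T"])
  show "\<exists>Fs fs R. main_inv n es D Fs fs R s \<and>
      main_time n (length es) D (length Fs) (length R) \<le> main_time n (length es) D 0 (length es)"
    using assms by (metis list.size(3) order_refl)
next
  fix s T assume "\<exists>Fs fs R. main_inv n es D Fs fs R s \<and> main_time n (length es) D (length Fs) (length R) \<le> T"
    and g: "bval (Less (N 0) (Var ''g'')) s"
  then obtain Fs fs R where inv: "main_inv n es D Fs fs R s"
    and T: "main_time n (length es) D (length Fs) (length R) \<le> T" by blast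
  obtain d f F S where c: "cover R R = (d, f, F, S)" by (rule prod_cases4)
  have R: "edges_within {..<n} R" using inv by (simp add: main_inv_def)
  note star = cover_star_forest[OF R finite_lessThan c]
  have less: "length Fs < max 1 D"
  proof (cases "Fs = []")
    case False
    then obtain e R' where "R = e # R'" using g inv by (cases R) (auto simp: main_inv_def)
    then have "0 < list_degree R (fst e)" by simp
    moreover have "list_degree R (fst e) \<le> D - length Fs" using inv by (simp add: main_inv_def)
    ultimately show ?thesis by linarith
  qed simp
  let ?T1 = "50 * (n + length R + 1) + 7 * n * length F"
    and ?T2 = "main_time n (length es) D (Suc (length Fs)) (length S)"
  have "runs cover_round s ?T1 (\<lambda>s'.
    s' ''n'' 0 = n \<and> s' ''r'' 0 = length S \<and> s' ''g'' 0 = length S \<and> s' ''k'' 0 = Suc (s ''k'' 0) \<and>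
    edges_at s' ''in'' 2 S \<and> out_tape s' (concat (map enc_edges Fs) @ enc_edges F) \<and>
    tape s' (concat (map enc_cotree (map (star_tree [0..<n]) fs)) @ enc_cotree (star_tree [0..<n] f)))"
    by (rule runs_cover_round) (use inv c in \<open>auto simp: main_inv_def\<close>)
  then have "runs cover_round s ?T1 (main_inv n es D (Fs @ [F]) (fs @ [f]) S)"
  proof (rule runs_mono)
    fix s' assume s': "s' ''n'' 0 = n \<and> s' ''r'' 0 = length S \<and> s' ''g'' 0 = length S \<and>
      s' ''k'' 0 = Suc (s ''k'' 0) \<and>
      edges_at s' ''in'' 2 S \<and> out_tape s' (concat (map enc_edges Fs) @ enc_edges F) \<and>
      tape s' (concat (map enc_cotree (map (star_tree [0..<n]) fs)) @ enc_cotree (star_tree [0..<n] f))"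
    have "edges_within {..<n} S" using R star(3) by (auto simp: edges_within_def)
    moreover have "length S \<le> length es" using inv star(4) by (simp add: main_inv_def)
    moreover have "set (concat (Fs @ [F])) \<union> set S = set es"
      using inv star(3) by (auto simp: main_inv_def)
    moreover have "list_degree S x \<le> D - length (Fs @ [F])" for x
    proof -
      have "list_degree R x \<le> D - length Fs" using inv by (simp add: main_inv_def)
      then show ?thesis using star(5)[of x] by simp
    qed
    moreover have "list_all2 (\<lambda>F f. star_map {..<n} f \<and> edge_set F = star_edges {..<n} f) (Fs @ [F]) (fs @ [f])"
      using inv star(1,2) by (auto simp: main_inv_def intro!: list_all2_appendI)
    ultimately show "main_inv n es D (Fs @ [F]) (fs @ [f]) S s'"
      using s' inv less unfolding main_inv_def by simp
  qed simp
  then have "runs cover_round s ?T1 (\<lambda>s'. \<exists>Fs fs R. main_inv n es D Fs fs R s' \<and>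
      main_time n (length es) D (length Fs) (length R) \<le> ?T2)"
    by (rule runs_mono) (auto intro!: exI[of _ "Fs @ [F]"] exI)
  moreover have "1 + ?T1 + ?T2 \<le> T"
  proof -
    define a where "a = (max 1 D - Suc (length Fs)) * (51 * (n + length es + 1))"
    define b where "b = 7 * n * length F"
    define c where "c = 7 * n * length S"
    have "max 1 D - length Fs = Suc (max 1 D - Suc (length Fs))" using less by simp
    then have "main_time n (length es) D (length Fs) (length R) = 1 + (51 * (n + length es + 1) + a) + (b + c)"
      unfolding main_time_def star(4)[symmetric] a_def b_def c_def by (simp only: mult_Suc distrib_left)
    moreover have "?T2 = 1 + a + c" unfolding main_time_def a_def c_def ..
    moreover have "2 + 50 * (n + length R + 1) \<le> 1 + 51 * (n + length es + 1)"
      using inv by (simp add: main_inv_def)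
    ultimately show ?thesis using T unfolding b_def[symmetric] by linarith
  qed
  ultimately show "\<exists>T1 T2. 1 + T1 + T2 \<le> T \<and> runs cover_round s T1
      (\<lambda>s'. \<exists>Fs fs R. main_inv n es D Fs fs R s' \<and> main_time n (length es) D (length Fs) (length R) \<le> T2)"
    by blast
next
  fix s T assume "\<exists>Fs fs R. main_inv n es D Fs fs R s \<and> main_time n (length es) D (length Fs) (length R) \<le> T"
    and g: "\<not> bval (Less (N 0) (Var ''g'')) s"
  then obtain Fs fs R where inv: "main_inv n es D Fs fs R s"
    and T: "main_time n (length es) D (length Fs) (length R) \<le> T" by blast
  have "Fs \<noteq> []" "R = []" using inv g by (auto simp: main_inv_def split: if_splits)
  then show "1 \<le> T \<and> (\<exists>Fs fs. Fs \<noteq> [] \<and> main_inv n es D Fs fs [] s)"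
    using inv T by (auto simp: main_time_def)
qed

abbreviation copy_body :: com where
  "copy_body \<equiv> Write ''out'' (Plus (Plus (Var ''p'') (N 1)) (Var ''i'')) (Read ''t'' (Var ''i''))"

definition finish :: com where
  "finish = Seq (Write ''out'' (N 0) (Var ''k'')) (If (Less (N 0) (Var ''n''))
    (Seq (Write ''out'' (Var ''p'') (Var ''k'')) (For ''i'' ''q'' copy_body))
    (Write ''out'' (Var ''p'') (N 0)))"

lemma runs_finish:
  assumes k: "s ''k'' 0 = k" and n: "s ''n'' 0 = n" and ys: "out_tape s ys" and xs: "tape s xs"
  shows "runs finish s (5 + 3 * length xs)
    (\<lambda>s'. outputs s' (k # ys @ (if n = 0 then [0] else k # xs)))"
proof -
  let ?s = "s(''out'' := (s ''out'')(0 := k))"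
  let ?s' = "s(''out'' := (s ''out'')(0 := k, Suc (length ys) := k))"
  let ?Q = "\<lambda>s'. outputs s' (k # ys @ (if n = 0 then [0] else k # xs))"
  have p: "s ''p'' 0 = Suc (length ys)" and out: "\<forall>i<length ys. s ''out'' (Suc i) = ys ! i"
    using ys by (auto simp: out_tape_def)
  let ?I = "\<lambda>j s'. s' ''i'' 0 = j \<and> agree {''i'', ''out''} s' s \<and>
    outputs s' (k # ys @ k # take j xs)"
  have loop: "runs (For ''i'' ''q'' copy_body) ?s' (2 + (\<Sum>j<length xs. 1 + 2)) (?I (length xs))"
  proof (rule runs_For[where I = ?I])
    show "?I 0 (?s'(''i'' := (?s' ''i'')(0 := 0)))"
      using out by (auto simp: agree_upd outputs_def nth_append less_Suc_eq_0_disj)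
    show "s' ''i'' 0 = j \<and> s' ''q'' 0 = length xs" if "?I j s'" for j s'
      using that xs by (auto simp: tape_def dest: agreeD[where x = "''q''"])
    show "runs copy_body s' 1 (\<lambda>s'. ?I (Suc j) (s'(''i'' := (s' ''i'')(0 := Suc (s' ''i'' 0)))))"
      if j: "j < length xs" and I: "?I j s'" for j s'
    proof (rule runs_loop_free)
      have eq: "s' ''p'' = s ''p''" "s' ''t'' = s ''t''" using I by (simp_all add: agree_def)
      have fin: "final copy_body s' = s'(''out'' := (s' ''out'')(Suc (Suc (length ys + j)) := xs ! j))"
        using I eq p xs j by (simp add: tape_def)
      have tk: "k # ys @ k # take (Suc j) xs = (k # ys @ k # take j xs) @ [xs ! j]"
        using j by (simp add: take_Suc_conv_app_nth)
      have "outputs (final copy_body s') (k # ys @ k # take (Suc j) xs)"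
        unfolding tk fin using I j by (auto simp: outputs_def nth_append less_Suc_eq simp del: append_Cons append_assoc)
      then show "?I (Suc j) ((final copy_body s')(''i'' := (final copy_body s' ''i'')
          (0 := Suc (final copy_body s' ''i'' 0))))"
        using I by (simp add: fin agree_upd outputs_def)
    qed simp_all
  qed
  have 1: "runs (Write ''out'' (N 0) (Var ''k'')) s 1 (\<lambda>s'. s' = ?s)"
    by (rule runs_loop_free) (use k in simp_all)
  have 2: "runs (If (Less (N 0) (Var ''n''))
    (Seq (Write ''out'' (Var ''p'') (Var ''k'')) (For ''i'' ''q'' copy_body))
    (Write ''out'' (Var ''p'') (N 0))) ?s (1 + (1 + (2 + (\<Sum>j<length xs. 1 + 2)))) ?Q"
  proof (rule runs_If)
    assume "bval (Less (N 0) (Var ''n'')) ?s"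
    then have "0 < n" using n by simp
    have 3: "runs (Write ''out'' (Var ''p'') (Var ''k'')) ?s 1 (\<lambda>s'. s' = ?s')"
      by (rule runs_loop_free) (use p k in simp_all)
    show "runs (Seq (Write ''out'' (Var ''p'') (Var ''k'')) (For ''i'' ''q'' copy_body)) ?s
        (1 + (2 + (\<Sum>j<length xs. 1 + 2))) ?Q"
    proof (rule runs_Seq[OF 3])
      fix s' assume "s' = ?s'"
      then show "runs (For ''i'' ''q'' copy_body) s' (2 + (\<Sum>j<length xs. 1 + 2)) ?Q"
        using loop \<open>0 < n\<close> by (auto elim!: runs_mono)
    qed
  next
    assume "\<not> bval (Less (N 0) (Var ''n'')) ?s"
    then have "n = 0" using n by simp
    then show "runs (Write ''out'' (Var ''p'') (N 0)) ?s (1 + (2 + (\<Sum>j<length xs. 1 + 2))) ?Q"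
      by (intro runs_loop_free) (use p out in \<open>auto simp: outputs_def nth_append less_Suc_eq_0_disj\<close>)
  qed
  have "runs finish s (1 + (1 + (1 + (2 + (\<Sum>j<length xs. 1 + 2))))) ?Q"
    unfolding finish_def by (rule runs_Seq[OF 1]) (use 2 in simp)
  then show ?thesis by (rule runs_mono) auto
qed

definition prepare :: com where
  "prepare = Seq (Assign ''n'' (Read ''in'' (N 0))) (Seq (Assign ''r'' (Read ''in'' (N 1)))
    (Seq (Assign ''p'' (N 1)) (Assign ''g'' (N 1))))"

definition decompose :: com where
  "decompose = Seq prepare (Seq main_loop finish)"

lemma edges_of_eq: "edges_of = edge_set"
  by (simp add: fun_eq_iff edges_of_def edge_set_def)

lemma graph_input_edges:
  assumes "graph_input n es"
  shows "edges_within {..<n} es" "distinct (map (\<lambda>(u, v). {u, v}) es)"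
    "card (edges_of es) = length es" "list_degree es x \<le> max_degree {..<n} (edges_of es)"
proof -
  show w: "edges_within {..<n} es" and d: "distinct (map (\<lambda>(u, v). {u, v}) es)"
    using assms by (auto simp: graph_input_def edges_within_def)
  show "card (edges_of es) = length es"
    using distinct_card[OF d] by (simp add: edges_of_def)
  show "list_degree es x \<le> max_degree {..<n} (edges_of es)"
    unfolding edges_of_eq by (rule list_degree_le_max_degree[OF d _ w]) simp
qed

lemma runs_prepare:
  assumes "graph_input n es"
  shows "runs prepare (load (enc_graph n es)) 4 (main_inv n es (max_degree {..<n} (edges_of es)) [] [] es)"
proof (rule runs_loop_free)
  let ?s = "load (enc_graph n es)"
  let ?fl = "concat (map (\<lambda>(u, v). [u, v]) es)"
  have in_eq: "?s ''in'' i = (n # length es # ?fl) ! i" if "i < Suc (Suc (length es + length es))" for i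
    using that by (simp add: load_def enc_graph_def enc_edges_def length_flat)
  have other: "?s x = (\<lambda>_. 0)" if "x \<noteq> ''in''" for x
    using that by (simp add: load_def)
  have "edges_at ?s ''in'' 2 es"
    using in_eq by (simp add: edges_at_flat)
  then show "main_inv n es (max_degree {..<n} (edges_of es)) [] [] es (final prepare ?s)"
    using graph_input_edges[OF assms] in_eq[of 0] in_eq[of 1]
    by (simp add: main_inv_def prepare_def other out_tape_def tape_def edges_at_def)
qed (simp_all add: prepare_def)

lemma main_inv_correct_result:
  assumes inv: "main_inv n es (max_degree {..<n} (edges_of es)) Fs fs [] s" and ne: "Fs \<noteq> []"
  shows "correct_result n es Fs (if n = 0 then [] else map (star_tree [0..<n]) fs)"
proof -
  have star: "list_all2 (\<lambda>F f. star_map {..<n} f \<and> edge_set F = star_edges {..<n} f) Fs fs"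
    and es: "set (concat Fs) = set es" and len: "length Fs \<le> max 1 (max_degree {..<n} (edges_of es))"
    using inv by (auto simp: main_inv_def)
  have cog: "cograph {..<n} (edges_of F)" if F: "F \<in> set Fs" for F
  proof -
    obtain i where i: "i < length Fs" "F = Fs ! i" using F by (auto simp: in_set_conv_nth)
    then have "star_map {..<n} (fs ! i)" "edge_set F = star_edges {..<n} (fs ! i)"
      using list_all2_nthD[OF star i(1)] by simp_all
    then show ?thesis by (simp add: edges_of_eq cograph_star_edges)
  qed
  have un: "(\<Union>F\<in>set (map edges_of Fs). F) = edges_of es"
    unfolding edges_of_def es[symmetric] by auto
  have "cograph_decomposition {..<n} (edges_of es) (length Fs) (map edges_of Fs)"
    unfolding cograph_decomposition_def
  proof (intro conjI ballI)
    fix F assume F: "F \<in> set (map edges_of Fs)"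
    show "F \<subseteq> edges_of es" unfolding un[symmetric] using F by blast
    show "cograph {..<n} F" using F cog by auto
  qed (use un in simp_all)
  moreover have "1 \<le> length Fs" using ne by (cases Fs) auto
  moreover have "list_all2 (cotree_of {..<n}) (map edges_of Fs) (map (star_tree [0..<n]) fs)" if "n \<noteq> 0"
    unfolding list_all2_map1 list_all2_map2
    using star
  proof (rule list_all2_mono)
    fix F f assume "star_map {..<n} f \<and> edge_set F = star_edges {..<n} f"
    then show "cotree_of {..<n} (edges_of F) (star_tree [0..<n] f)"
      using cotree_of_star_tree[of "[0..<n]" f] that by (simp add: edges_of_eq lessThan_atLeast0)
  qed
  ultimately show ?thesis
    using len unfolding correct_result_def by (auto intro!: exI[of _ "length Fs"])
qed

lemma main_inv_enc_result:
  assumes "main_inv n es D Fs fs R s"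
  shows "length Fs # concat (map enc_edges Fs) @ (if n = 0 then [0] else
      length Fs # concat (map enc_cotree (map (star_tree [0..<n]) fs))) =
    enc_result Fs (if n = 0 then [] else map (star_tree [0..<n]) fs)"
proof -
  have "length fs = length Fs" using assms by (auto simp: main_inv_def dest: list_all2_lengthD)
  then show ?thesis by (simp add: enc_result_def)
qed

lemma length_main_tape:
  assumes "main_inv n es D Fs fs R s"
  shows "length (concat (map enc_cotree (map (star_tree [0..<n]) fs))) \<le> max 1 D * (2 + 6 * n)"
proof -
  have len: "length fs = length Fs" "length Fs \<le> max 1 D" and star: "\<forall>f\<in>set fs. star_map {..<n} f"
    using assms by (auto simp: main_inv_def list_all2_conv_all_nth in_set_conv_nth)
  have "length (concat (map enc_cotree (map (star_tree [0..<n]) fs))) \<le> length fs * (2 + 6 * n)"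
    using star by (induction fs) (auto simp del: upt_Suc dest!: length_enc_star_tree)
  also have "\<dots> \<le> max 1 D * (2 + 6 * n)" using len by (intro mult_right_mono) auto
  finally show ?thesis .
qed

lemma total_time_le:
  assumes "m = 0 \<Longrightarrow> D = 0" "0 < m \<Longrightarrow> 0 < D \<and> 0 < n"
  shows "4 + (main_time n m D 0 m + (5 + 3 * (max 1 D * (2 + 6 * n)))) \<le> 200 * time_bound n m D"
proof (cases "m = 0")
  case True
  then show ?thesis using assms(1) by (simp add: main_time_def time_bound_def)
next
  case False
  then have D: "max 1 D = D" "1 \<le> D" "1 \<le> n * m" "D \<le> D * n" using assms(2) by auto
  have "4 + (main_time n m D 0 m + (5 + 3 * (max 1 D * (2 + 6 * n)))) =
      10 + 69 * (D * n) + 51 * (D * m) + 57 * D + 7 * (n * m)"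
    unfolding main_time_def D(1) by (simp add: algebra_simps)
  also have "\<dots> \<le> 200 * (n * m) + 200 * (D * n) + 200 * (D * m)" using D(3,4) by linarith
  finally show ?thesis using False by (simp add: time_bound_def algebra_simps)
qed

lemma decompose_correct:
  assumes G: "graph_input n es"
  shows "\<exists>t s Fs Ts. exec decompose (load (enc_graph n es)) t s \<and>
    t \<le> 200 * time_bound n (card (edges_of es)) (max_degree {..<n} (edges_of es)) \<and>
    outputs s (enc_result Fs Ts) \<and> correct_result n es Fs Ts"
proof -
  let ?D = "max_degree {..<n} (edges_of es)" and ?m = "length es"
  let ?Q = "\<lambda>s. \<exists>Fs Ts. outputs s (enc_result Fs Ts) \<and> correct_result n es Fs Ts"
  have fin: "runs finish s (5 + 3 * (max 1 ?D * (2 + 6 * n))) ?Q"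
    if ex: "\<exists>Fs fs. Fs \<noteq> [] \<and> main_inv n es ?D Fs fs [] s" for s
  proof -
    obtain Fs fs where ne: "Fs \<noteq> []" and inv: "main_inv n es ?D Fs fs [] s" using ex by blast
    let ?xs = "concat (map enc_cotree (map (star_tree [0..<n]) fs))"
    have "runs finish s (5 + 3 * length ?xs) (\<lambda>s'. outputs s' (length Fs #
        concat (map enc_edges Fs) @ (if n = 0 then [0] else length Fs # ?xs)))"
      by (rule runs_finish) (use inv in \<open>simp_all add: main_inv_def\<close>)
    then show ?thesis
      unfolding main_inv_enc_result[OF inv]
    proof (rule runs_mono)
      show "5 + 3 * length ?xs \<le> 5 + 3 * (max 1 ?D * (2 + 6 * n))"
        using length_main_tape[OF inv] by linarith
    qed (use main_inv_correct_result[OF inv ne] in blast)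
  qed
  have "runs decompose (load (enc_graph n es))
      (4 + (main_time n ?m ?D 0 ?m + (5 + 3 * (max 1 ?D * (2 + 6 * n))))) ?Q"
    unfolding decompose_def
    by (rule runs_Seq[OF runs_prepare[OF G]], rule runs_Seq[OF runs_main_loop], assumption, rule fin)
  moreover have "4 + (main_time n ?m ?D 0 ?m + (5 + 3 * (max 1 ?D * (2 + 6 * n)))) \<le>
      200 * time_bound n ?m ?D"
  proof (rule total_time_le)
    assume "?m = 0"
    then have "edges_of es = {}" by (simp add: edges_of_def)
    then have "degree (edges_of es) ` {..<n} \<subseteq> {0}" by (auto simp: degree_def)
    then have "insert 0 (degree (edges_of es) ` {..<n}) = {0}" by auto
    then show "?D = 0" unfolding max_degree_def by (simp only: Max_singleton)
  next
    assume "0 < ?m"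
    then obtain e es' where es: "es = e # es'" by (cases es) auto
    then have "0 < list_degree es (fst e)" by simp
    then have "0 < ?D" using graph_input_edges(4)[OF G, of "fst e"] by linarith
    moreover have "0 < n" using graph_input_edges(1)[OF G] es by (auto simp: edges_within_def)
    ultimately show "0 < ?D \<and> 0 < n" by simp
  qed
  ultimately show ?thesis
    unfolding runs_def graph_input_edges(3)[OF G] by (meson order_trans)
qed

theorem theorem8:
  shows "(\<forall>(V :: 'a set) E. simple_graph V E \<longrightarrow>
            (\<exists>k Es. 1 \<le> k \<and> k \<le> max_degree V E + 1 \<and> cograph_decomposition V E k Es)) \<and>
         (\<exists>P c. \<forall>n es. graph_input n es \<longrightarrow>
            (\<exists>t s Fs Ts. exec P (load (enc_graph n es)) t s \<and>
               t \<le> c * time_bound n (card (edges_of es)) (max_degree {..<n} (edges_of es)) \<and>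
               outputs s (enc_result Fs Ts) \<and> correct_result n es Fs Ts)) \<and>
         (\<forall>(V :: 'a set) E. simple_graph V E \<longrightarrow>
            (\<exists>TT. finite TT \<and> card TT \<le> max_degree V E + 1 \<and> represented_by V E TT))"
proof (intro conjI)
  show "\<exists>P c. \<forall>n es. graph_input n es \<longrightarrow>
      (\<exists>t s Fs Ts. exec P (load (enc_graph n es)) t s \<and>
         t \<le> c * time_bound n (card (edges_of es)) (max_degree {..<n} (edges_of es)) \<and>
         outputs s (enc_result Fs Ts) \<and> correct_result n es Fs Ts)"
    using decompose_correct by blast
qed (use graph_cograph_decomposition graph_represented_by_cotrees in blast)+

end
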